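(* Let $n\ge 3$ be odd (so that $n+1$ is even) and let $W=W(D_{n+1})$ be the Coxeter group of type $D_{n+1}$, with longest element $w_o$ (which is central and acts as $-1$ in the reflection representation). For integers $l\in\{0,\dots,n\}$ and $k\in\{0,\dots,\lfloor (n-l)/2\rfloor\}$ let $$I_{k,l}=\{2i-1 : 1\le i\le k\}\cup J_l\subset\{1,\dots,n+1\},\qquad J_0=\emptyset,\quad J_l=\{n+1-l,\dots,n+1\}\ \text{ for } l>0,$$ and $c_{k,l}:=w_{I_{k,l}}$. Let $c_-:=w_{I_-}$ and $c_+:=w_{I_+}$ with $I_-=\{1,3,5,\dots,n-2,n\}$ and $I_+=\{1,3,5,\dots,n-2,n+1\}$. Then: (i) each involution in $W$ is conjugate to at least one of the involutions $c_{k,l}$, or to precisely one of the two involutions $c_-$, $c_+$; (ii) $c_{k,l}$ is a standard involution if and only if $l$ is odd; (iii) for even $l\ge 2$, $c_{k,l}$ is conjugate to $c_{k,l-1}$; (iv) for all integers $l\in\{0,\dots,n\}$ and $k\in\{0,\dots,\lfloor (n-l)/2\rfloor\}$, $w_o c_{k,l}$ is conjugate to $c_{k,\,n-2k-l}$; (v) if $n+1\equiv 0 \pmod 4$, then $w_oc_-$ is conjugate to $c_-$ and $w_oc_+$ is conjugate to $c_+$; if $n+1\equiv 2\pmod 4$, then $w_oc_-$ is conjugate to $c_+$ and $w_oc_+$ is conjugate to $c_-$.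
   Context: The Coxeter graph $D_{n+1}$ has nodes $1,\dots,n+1$; nodes $1,\dots,n-1$ form a path in this order, and nodes $n$ and $n+1$ are the two further nodes, each joined (only) to node $n-1$; all edges have label $3$. Node $i$ corresponds to the simple generator $s_i$. For a set of nodes $I$, $W_I$ denotes the parabolic subgroup generated by $\{s_i: i\in I\}$, and $w_I$ denotes its longest element. The involution $w_I$ is called standard if $w_I$ is central in $W_I$. An involution is an element $x$ with $x^2=1$ (the identity is included). Conjugacy is conjugacy in $W$.
   Formalization: In (ii), "if and only if l is odd" is replaced by "if and only if l is odd or l = 0": for l = 0 the element c_{k,0} is a product of pairwise commuting generators (e.g. c_{0,0} = 1), hence standard although 0 is even. *)

theory Defs
  imports "HOL-Algebra.Generated_Groups"
begin

section \<open>Coxeter groups by generators and relations\<close>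

text \<open>
  \<open>m i j\<close> is the order imposed on \<open>s\<^sub>i s\<^sub>j\<close>, with \<open>0\<close> encoding \<open>\<infinity>\<close>
  (the relation is then void). As \<open>m i i = 1\<close> in a Coxeter matrix, the instance \<open>i = j\<close> of the
  relation is \<open>s\<^sub>i s\<^sub>i = 1\<close>, so words in the generators alone (without formal inverses) suffice.
\<close>

definition coxeter_matrix :: "'s set \<Rightarrow> ('s \<Rightarrow> 's \<Rightarrow> nat) \<Rightarrow> bool" where
  "coxeter_matrix S m \<longleftrightarrow>
     (\<forall>i\<in>S. \<forall>j\<in>S. m i j = m j i \<and> (m i j = 1 \<longleftrightarrow> i = j))"

inductive coxeter_cong :: "'s set \<Rightarrow> ('s \<Rightarrow> 's \<Rightarrow> nat) \<Rightarrow> 's list \<Rightarrow> 's list \<Rightarrow> bool"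
  for S m where
  refl: "u \<in> lists S \<Longrightarrow> coxeter_cong S m u u"
| sym: "coxeter_cong S m u v \<Longrightarrow> coxeter_cong S m v u"
| trans: "coxeter_cong S m u v \<Longrightarrow> coxeter_cong S m v w \<Longrightarrow> coxeter_cong S m u w"
| rel: "i \<in> S \<Longrightarrow> j \<in> S \<Longrightarrow> u \<in> lists S \<Longrightarrow> v \<in> lists S \<Longrightarrow>
    coxeter_cong S m (u @ concat (replicate (m i j) [i, j]) @ v) (u @ v)"

definition coxeter_rel :: "'s set \<Rightarrow> ('s \<Rightarrow> 's \<Rightarrow> nat) \<Rightarrow> ('s list \<times> 's list) set" where
  "coxeter_rel S m = {(u, v). coxeter_cong S m u v}"

definition coxeter_group :: "'s set \<Rightarrow> ('s \<Rightarrow> 's \<Rightarrow> nat) \<Rightarrow> 's list set monoid" where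
  "coxeter_group S m =
     \<lparr>carrier = lists S // coxeter_rel S m,
      mult = (\<lambda>X Y. \<Union>u\<in>X. \<Union>v\<in>Y. coxeter_rel S m `` {u @ v}),
      one = coxeter_rel S m `` {[]}\<rparr>"

definition coxeter_gen :: "'s set \<Rightarrow> ('s \<Rightarrow> 's \<Rightarrow> nat) \<Rightarrow> 's \<Rightarrow> 's list set" where
  "coxeter_gen S m i = coxeter_rel S m `` {[i]}"

text \<open>An element of the group is the set of all words representing it.\<close>

definition coxeter_length :: "'s list set \<Rightarrow> nat" where
  "coxeter_length x = (LEAST k. \<exists>u\<in>x. length u = k)"

definition parabolic :: "'s set \<Rightarrow> ('s \<Rightarrow> 's \<Rightarrow> nat) \<Rightarrow> 's set \<Rightarrow> 's list set set" where
  "parabolic S m I = generate (coxeter_group S m) (coxeter_gen S m ` I)"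

definition longest_element :: "'s set \<Rightarrow> ('s \<Rightarrow> 's \<Rightarrow> nat) \<Rightarrow> 's set \<Rightarrow> 's list set" where
  "longest_element S m I =
     (THE w. w \<in> parabolic S m I \<and> (\<forall>v\<in>parabolic S m I. coxeter_length v \<le> coxeter_length w))"

text \<open>
  \<open>w\<^sub>I\<close> is also standard when the generators in \<open>I\<close> commute pairwise, in particular when \<open>I\<close> is empty.
\<close>

definition standard_involution :: "'s set \<Rightarrow> ('s \<Rightarrow> 's \<Rightarrow> nat) \<Rightarrow> 's list set \<Rightarrow> bool" where
  "standard_involution S m x \<longleftrightarrow>
     (\<exists>I\<subseteq>S. x = longest_element S m I \<and>
        (\<forall>y\<in>parabolic S m I. x \<otimes>\<^bsub>coxeter_group S m\<^esub> y = y \<otimes>\<^bsub>coxeter_group S m\<^esub> x))"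

definition involution :: "('a, 'b) monoid_scheme \<Rightarrow> 'a \<Rightarrow> bool" where
  "involution G x \<longleftrightarrow> x \<in> carrier G \<and> x \<otimes>\<^bsub>G\<^esub> x = \<one>\<^bsub>G\<^esub>"

definition conjugate_in :: "('a, 'b) monoid_scheme \<Rightarrow> 'a \<Rightarrow> 'a \<Rightarrow> bool" where
  "conjugate_in G x y \<longleftrightarrow>
     x \<in> carrier G \<and> y \<in> carrier G \<and> (\<exists>g\<in>carrier G. y = g \<otimes>\<^bsub>G\<^esub> x \<otimes>\<^bsub>G\<^esub> inv\<^bsub>G\<^esub> g)"

lemma coxeter_cong_lists:
  "coxeter_cong S m u v \<Longrightarrow> u \<in> lists S \<and> v \<in> lists S"
  by (induction rule: coxeter_cong.induct) (auto split: if_splits)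

lemma equiv_coxeter_rel: "equiv (lists S) (coxeter_rel S m)"
proof (rule equivI)
  show "coxeter_rel S m \<subseteq> lists S \<times> lists S"
  proof (rule subsetI)
    fix p assume "p \<in> coxeter_rel S m"
    then obtain u v where "p = (u, v)" "coxeter_cong S m u v"
      unfolding coxeter_rel_def by (cases p) simp
    with coxeter_cong_lists[of S m u v] show "p \<in> lists S \<times> lists S" by simp
  qed
  show "refl_on (lists S) (coxeter_rel S m)"
    by (rule refl_onI) (simp add: coxeter_rel_def coxeter_cong.refl del: in_lists_conv_set)
  show "sym (coxeter_rel S m)"
    by (rule symI) (simp add: coxeter_rel_def coxeter_cong.sym)
  show "trans (coxeter_rel S m)"
    by (rule transI) (simp add: coxeter_rel_def, erule (1) coxeter_cong.trans)
qed

lemma coxeter_cong_context: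
  "coxeter_cong S m u v \<Longrightarrow> p \<in> lists S \<Longrightarrow> q \<in> lists S \<Longrightarrow> coxeter_cong S m (p @ u @ q) (p @ v @ q)"
proof (induction rule: coxeter_cong.induct)
  case (refl u)
  then show ?case by (intro coxeter_cong.refl) simp
next
  case (sym u v)
  then show ?case by (intro coxeter_cong.sym[OF sym.IH])
next
  case (trans u v w)
  then show ?case by (intro coxeter_cong.trans[OF trans.IH])
next
  case (rel i j u v)
  then show ?case using coxeter_cong.rel[of i S j "p @ u" "v @ q" m] by simp
qed

lemma coxeter_mult_class:
  assumes "u \<in> lists S" "v \<in> lists S"
  shows "coxeter_rel S m `` {u} \<otimes>\<^bsub>coxeter_group S m\<^esub> coxeter_rel S m `` {v}
    = coxeter_rel S m `` {u @ v}"
proof -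
  have "coxeter_rel S m `` {u' @ v'} = coxeter_rel S m `` {u @ v}"
    if "u' \<in> coxeter_rel S m `` {u}" "v' \<in> coxeter_rel S m `` {v}" for u' v'
  proof -
    have u': "coxeter_cong S m u u'" and v': "coxeter_cong S m v v'"
      using that unfolding coxeter_rel_def by auto
    have "coxeter_cong S m (u @ v) (u' @ v)"
      using coxeter_cong_context[OF u', of "[]" v] assms by simp
    moreover have "coxeter_cong S m (u' @ v) (u' @ v')"
      using coxeter_cong_context[OF v', of u' "[]"] coxeter_cong_lists[OF u'] by simp
    ultimately have "(u @ v, u' @ v') \<in> coxeter_rel S m"
      unfolding coxeter_rel_def using coxeter_cong.trans[of S m "u @ v" "u' @ v" "u' @ v'"] by simp
    then show ?thesis using equiv_class_eq[OF equiv_coxeter_rel] by metis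
  qed
  then have "(\<Union>u'\<in>coxeter_rel S m `` {u}. \<Union>v'\<in>coxeter_rel S m `` {v}. coxeter_rel S m `` {u' @ v'})
    = (\<Union>u'\<in>coxeter_rel S m `` {u}. \<Union>v'\<in>coxeter_rel S m `` {v}. coxeter_rel S m `` {u @ v})"
    by (intro SUP_cong HOL.refl)
  moreover have "coxeter_rel S m `` {u} \<noteq> {}" "coxeter_rel S m `` {v} \<noteq> {}"
    using equiv_class_self[OF equiv_coxeter_rel] assms by (metis empty_iff)+
  ultimately show ?thesis
    by (simp add: coxeter_group_def)
qed

lemma coxeter_group_is_group:
  assumes "coxeter_matrix S m"
  shows "group (coxeter_group S m)"
proof -
  let ?G = "coxeter_group S m" and ?cl = "\<lambda>u. coxeter_rel S m `` {u}"
  have carr: "x \<in> carrier ?G \<longleftrightarrow> (\<exists>u\<in>lists S. x = ?cl u)" for x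
    unfolding coxeter_group_def quotient_def by auto
  have one: "\<one>\<^bsub>?G\<^esub> = ?cl []"
    unfolding coxeter_group_def by simp
  have inverse: "coxeter_cong S m (rev u @ u) []" if "u \<in> lists S" for u
    using that
  proof (induction u)
    case Nil
    then show ?case by (simp add: coxeter_cong.refl)
  next
    case (Cons a u)
    then have "m a a = 1" "a \<in> S" "u \<in> lists S"
      using assms unfolding coxeter_matrix_def by auto
    moreover from this have "rev u \<in> lists S" by auto
    ultimately have "coxeter_cong S m (rev u @ [a, a] @ u) (rev u @ u)"
      using coxeter_cong.rel[of a S a "rev u" u m] by simp
    from coxeter_cong.trans[OF this Cons.IH] \<open>u \<in> lists S\<close> show ?case by simp
  qed
  have mult: "?cl u \<otimes>\<^bsub>?G\<^esub> ?cl v = ?cl (u @ v)" if "u \<in> lists S" "v \<in> lists S" for u v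
    using coxeter_mult_class[OF that] .
  have app: "u @ v \<in> lists S" if "u \<in> lists S" "v \<in> lists S" for u v
    using that by simp
  show ?thesis
  proof (rule groupI)
    fix x y assume "x \<in> carrier ?G" "y \<in> carrier ?G"
    then obtain u v where "u \<in> lists S" "v \<in> lists S" "x = ?cl u" "y = ?cl v"
      using carr by metis
    then show "x \<otimes>\<^bsub>?G\<^esub> y \<in> carrier ?G"
      using carr mult app by metis
  next
    show "\<one>\<^bsub>?G\<^esub> \<in> carrier ?G"
      unfolding carr one by (rule bexI[of _ "[]"]) simp_all
  next
    fix x y z assume "x \<in> carrier ?G" "y \<in> carrier ?G" "z \<in> carrier ?G"
    then obtain u v w where "u \<in> lists S" "v \<in> lists S" "w \<in> lists S"
      "x = ?cl u" "y = ?cl v" "z = ?cl w"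
      using carr by metis
    then show "x \<otimes>\<^bsub>?G\<^esub> y \<otimes>\<^bsub>?G\<^esub> z = x \<otimes>\<^bsub>?G\<^esub> (y \<otimes>\<^bsub>?G\<^esub> z)"
      by (simp only: mult app append_assoc)
  next
    fix x assume "x \<in> carrier ?G"
    then obtain u where u: "u \<in> lists S" "x = ?cl u"
      using carr by metis
    show "\<one>\<^bsub>?G\<^esub> \<otimes>\<^bsub>?G\<^esub> x = x"
      using mult[of "[]" u] u by (simp only: one append_Nil lists.Nil)
    have r: "rev u \<in> lists S" using u(1) by auto
    have "(rev u @ u, []) \<in> coxeter_rel S m"
      using inverse[OF u(1)] unfolding coxeter_rel_def by simp
    then have "?cl (rev u @ u) = ?cl []"
      by (rule equiv_class_eq[OF equiv_coxeter_rel])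
    then have "?cl (rev u) \<otimes>\<^bsub>?G\<^esub> x = \<one>\<^bsub>?G\<^esub>"
      using mult[OF r u(1)] u one by simp
    moreover have "?cl (rev u) \<in> carrier ?G" using carr r by metis
    ultimately show "\<exists>y\<in>carrier ?G. y \<otimes>\<^bsub>?G\<^esub> x = \<one>\<^bsub>?G\<^esub>" by metis
  qed
qed


section \<open>Type \<open>D\<^sub>n\<^sub>+\<^sub>1\<close>\<close>

definition D_nodes :: "nat \<Rightarrow> nat set" where
  "D_nodes n = {1..n + 1}"

text \<open>Each edge is listed once, with the smaller node first.\<close>

definition D_edges :: "nat \<Rightarrow> (nat \<times> nat) set" where
  "D_edges n = {(i, i + 1) |i. 1 \<le> i \<and> i + 1 \<le> n - 1} \<union> {(n - 1, n), (n - 1, n + 1)}"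

definition D_matrix :: "nat \<Rightarrow> nat \<Rightarrow> nat \<Rightarrow> nat" where
  "D_matrix n i j =
     (if i = j then 1 else if (i, j) \<in> D_edges n \<or> (j, i) \<in> D_edges n then 3 else 2)"

lemma coxeter_matrix_D: "coxeter_matrix (D_nodes n) (D_matrix n)"
  unfolding coxeter_matrix_def D_matrix_def by auto

abbreviation W_D :: "nat \<Rightarrow> nat list set monoid" where
  "W_D n \<equiv> coxeter_group (D_nodes n) (D_matrix n)"

abbreviation w_D :: "nat \<Rightarrow> nat set \<Rightarrow> nat list set" where
  "w_D n I \<equiv> longest_element (D_nodes n) (D_matrix n) I"

definition w_o :: "nat \<Rightarrow> nat list set" where
  "w_o n = w_D n (D_nodes n)"

definition J_set :: "nat \<Rightarrow> nat \<Rightarrow> nat set" where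
  "J_set n l = (if l = 0 then {} else {n + 1 - l..n + 1})"

definition I_set :: "nat \<Rightarrow> nat \<Rightarrow> nat \<Rightarrow> nat set" where
  "I_set n k l = {2 * i - 1 |i. 1 \<le> i \<and> i \<le> k} \<union> J_set n l"

definition c_inv :: "nat \<Rightarrow> nat \<Rightarrow> nat \<Rightarrow> nat list set" where
  "c_inv n k l = w_D n (I_set n k l)"

definition c_minus :: "nat \<Rightarrow> nat list set" where
  "c_minus n = w_D n ({i. odd i \<and> i \<le> n - 2} \<union> {n})"

definition c_plus :: "nat \<Rightarrow> nat list set" where
  "c_plus n = w_D n ({i. odd i \<and> i \<le> n - 2} \<union> {n + 1})"

end

(*
  W(D_{n+1}) acts on the indices +-1, ..., +-(n+1) by the signed permutations with an even number
  of sign changes. Faithfulness is Matsumoto's theorem, proved by induction on the number of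
  inversions: this uses only how simple reflections permute the positive roots. The length is then
  the number of inversions, W_I is the stabilizer of the fundamental coweights outside I, and w_I is
  the only element of W_I for which all nodes in I are descents.

  Among all signed permutations, the conjugacy class of an involution is determined by the numbers
  of negated coordinates and of exchanged pairs. If some coordinate is fixed or negated, then a sign
  change of one coordinate centralizes the involution, and the classes do not split. Otherwise the
  involution only exchanges pairs, its centralizer consists of even elements, and its class splits
  into those of c_- and c_+. Multiplication by w_o = -1 interchanges fixed and negated coordinates.
*)

theory Submission
  imports Defs "HOL-Combinatorics.Permutations"
begin

section \<open>Signed permutations and their inversions\<close>

text \<open>Why \<open>l\<close> matters only through its parity class: an element of the group
  changes an even number of signs, while \<open>J_set n l\<close> has \<open>l + 1\<close>
  coordinates to negate. For odd \<open>l\<close> all of them are negated; for even \<open>l\<close>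
  one must be left alone. So \<open>l = 2 j - 1\<close> and \<open>l = 2 j\<close> both negate
  \<open>2 j\<close> coordinates, which is (iii), and (iv) says that this rounding is compatible
  with exchanging fixed and negated coordinates. The coordinate left alone is also what destroys
  centrality for even \<open>l \<ge> 2\<close>. The value \<open>l = 0\<close> is an exception,
  since the generators in \<open>I_set n k 0\<close> commute.

  As \<open>n + 1\<close> is even, -1 lies in the group, and the coordinates can be exhausted by
  pairs, so that a splitting class exists at all. The residue of \<open>n + 1\<close> modulo 4 in
  (v) comes from one explicit conjugator: changing the sign of one coordinate in each pair carries
  -\<open>c_minus\<close> to \<open>c_minus\<close>, and this takes (n + 1) / 2 sign changes. If
  that number is odd, one more sign change is required, and it exchanges \<open>c_minus\<close> and
  \<open>c_plus\<close>.\<close>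

definition coords :: "nat \<Rightarrow> int set" where
  "coords N = {x. x \<noteq> 0 \<and> \<bar>x\<bar> \<le> int N}"

definition signed_perms :: "nat \<Rightarrow> (int \<Rightarrow> int) set" where
  "signed_perms N = {w. w permutes coords N \<and> (\<forall>x. w (- x) = - w x)}"

text \<open>Not the sign of the permutation but the parity of the number of sign changes; its kernel
  is the Weyl group of type D inside that of type B.\<close>

definition signature :: "nat \<Rightarrow> (int \<Rightarrow> int) \<Rightarrow> int" where
  "signature N w = (\<Prod>x\<in>{1..int N}. sgn (w x))"

definition even_signed_perms :: "nat \<Rightarrow> (int \<Rightarrow> int) set" where
  "even_signed_perms N = {w \<in> signed_perms N. signature N w = 1}"

lemma finite_coords: "finite (coords N)"
  by (rule finite_subset[of _ "{- int N..int N}"]) (auto simp: coords_def)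

lemma coords_uminus [simp]: "- x \<in> coords N \<longleftrightarrow> x \<in> coords N"
  by (simp add: coords_def)

lemma signed_perms_uminus: "w \<in> signed_perms N \<Longrightarrow> w (- x) = - w x"
  by (simp add: signed_perms_def)

lemma signed_perms_inj: "w \<in> signed_perms N \<Longrightarrow> w x = w y \<longleftrightarrow> x = y"
  by (auto simp: signed_perms_def dest: permutes_inj injD)

lemma signed_perms_in [simp]: "w \<in> signed_perms N \<Longrightarrow> w x \<in> coords N \<longleftrightarrow> x \<in> coords N"
  by (simp add: signed_perms_def permutes_in_image)

lemma signed_perms_fix: "w \<in> signed_perms N \<Longrightarrow> x \<notin> coords N \<Longrightarrow> w x = x"
  unfolding signed_perms_def by (blast dest: permutes_not_in)

lemma signed_perms_abs_eq:
  assumes "w \<in> signed_perms N"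
  shows "\<bar>w x\<bar> = \<bar>w y\<bar> \<longleftrightarrow> \<bar>x\<bar> = \<bar>y\<bar>"
proof -
  have "w x = - w y \<longleftrightarrow> x = - y"
    using signed_perms_inj[OF assms, of x "- y"] signed_perms_uminus[OF assms, of y] by simp
  then show ?thesis
    using signed_perms_inj[OF assms, of x y] by (simp add: abs_eq_iff)
qed

lemma signed_perms_id: "id \<in> signed_perms N"
  by (simp add: signed_perms_def permutes_id)

lemma signed_perms_comp: "v \<in> signed_perms N \<Longrightarrow> w \<in> signed_perms N \<Longrightarrow> v \<circ> w \<in> signed_perms N"
  by (auto simp: signed_perms_def intro: permutes_compose)

lemma signed_perms_inv:
  assumes "w \<in> signed_perms N"
  shows "inv_into UNIV w \<in> signed_perms N"
proof -
  have p: "w permutes coords N" using assms by (simp add: signed_perms_def)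
  have "inv_into UNIV w (- x) = - inv_into UNIV w x" for x
    using signed_perms_uminus[OF assms, of "inv_into UNIV w x"] permutes_inverses[OF p] by metis
  then show ?thesis using permutes_inv[OF p] by (simp add: signed_perms_def)
qed

lemma signed_perms_inv_comp:
  assumes "w \<in> signed_perms N"
  shows "inv_into UNIV w \<circ> w = id" "w \<circ> inv_into UNIV w = id" "inv_into UNIV w (w x) = x" "w (inv_into UNIV w x) = x"
proof -
  have p: "w permutes coords N" using assms by (simp add: signed_perms_def)
  show "inv_into UNIV w \<circ> w = id" "w \<circ> inv_into UNIV w = id" "inv_into UNIV w (w x) = x" "w (inv_into UNIV w x) = x"
    using permutes_inverses[OF p] by auto
qed

lemma signed_perms_abs_bij:
  assumes "w \<in> signed_perms N"
  shows "bij_betw (\<lambda>x. \<bar>w x\<bar>) {1..int N} {1..int N}"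
proof -
  have inj: "inj_on (\<lambda>x. \<bar>w x\<bar>) {1..int N}"
    using signed_perms_abs_eq[OF assms] by (auto simp: inj_on_def)
  have "(\<lambda>x. \<bar>w x\<bar>) ` {1..int N} \<subseteq> {1..int N}"
  proof (clarify)
    fix x assume "x \<in> {1..int N}"
    then have "w x \<in> coords N" using signed_perms_in[OF assms, of x] by (simp add: coords_def)
    then show "\<bar>w x\<bar> \<in> {1..int N}" by (auto simp: coords_def)
  qed
  with inj show ?thesis
    by (metis bij_betw_def endo_inj_surj finite_atLeastAtMost_int)
qed

text \<open>Since \<open>v (- x) = - v x\<close>, the sign of \<open>v (w x)\<close> is that of
  \<open>v \<bar>w x\<bar>\<close> times that of \<open>w x\<close>, and taking \<open>x\<close> to
  \<open>\<bar>w x\<bar>\<close> permutes the positive coordinates.\<close>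

lemma signature_comp:
  assumes v: "v \<in> signed_perms N" and w: "w \<in> signed_perms N"
  shows "signature N (v \<circ> w) = signature N v * signature N w"
proof -
  have "sgn (v (w x)) = sgn (v \<bar>w x\<bar>) * sgn (w x)" if "x \<in> {1..int N}" for x
  proof (cases "w x > 0")
    case False
    have "w x \<noteq> 0" using signed_perms_in[OF w, of x] that by (auto simp: coords_def)
    with False have "w x < 0" by simp
    then show ?thesis using signed_perms_uminus[OF v, of "\<bar>w x\<bar>"] by simp
  qed simp
  then have "signature N (v \<circ> w) = (\<Prod>x\<in>{1..int N}. sgn (v \<bar>w x\<bar>)) * signature N w"
    unfolding signature_def by (simp add: prod.distrib[symmetric])
  also have "(\<Prod>x\<in>{1..int N}. sgn (v \<bar>w x\<bar>)) = signature N v"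
    unfolding signature_def using prod.reindex_bij_betw[OF signed_perms_abs_bij[OF w]] .
  finally show ?thesis .
qed

lemma signature_card:
  assumes w: "w \<in> signed_perms N"
  shows "signature N w = (- 1) ^ card {x \<in> {1..int N}. w x < 0}"
proof -
  have "signature N w = (\<Prod>x\<in>{1..int N}. if w x < 0 then - 1 else 1)"
    unfolding signature_def
  proof (rule prod.cong[OF HOL.refl])
    fix x assume "x \<in> {1..int N}"
    then have "w x \<noteq> 0" using signed_perms_in[OF w, of x] by (auto simp: coords_def)
    then show "sgn (w x) = (if w x < 0 then - 1 else 1)" by (simp add: sgn_if)
  qed
  also have "\<dots> = (- 1) ^ card {x \<in> {1..int N}. w x < 0}"
    by (simp add: prod.If_cases Int_def)
  finally show ?thesis .
qed

lemma signature_cases: "w \<in> signed_perms N \<Longrightarrow> signature N w = 1 \<or> signature N w = - 1"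
  by (simp add: signature_card) (metis neg_one_even_power neg_one_odd_power)

lemma even_signed_permsD: "w \<in> even_signed_perms N \<Longrightarrow> w \<in> signed_perms N"
  by (simp add: even_signed_perms_def)

lemma even_signed_perms_id: "id \<in> even_signed_perms N"
  by (auto simp: even_signed_perms_def signed_perms_id signature_def intro: prod.neutral)

lemma even_signed_perms_comp:
  "v \<in> even_signed_perms N \<Longrightarrow> w \<in> even_signed_perms N \<Longrightarrow> v \<circ> w \<in> even_signed_perms N"
  by (simp add: even_signed_perms_def signed_perms_comp signature_comp)

lemma signature_inv:
  assumes w: "w \<in> signed_perms N"
  shows "signature N (inv_into UNIV w) = signature N w"
proof -
  have "signature N (inv_into UNIV w) * signature N w = 1"
    using signature_comp[OF signed_perms_inv[OF w] w] signed_perms_inv_comp(1)[OF w]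
      even_signed_perms_id[of N] by (simp add: even_signed_perms_def)
  then show ?thesis using signature_cases[OF w] by auto
qed

lemma even_signed_perms_inv: "w \<in> even_signed_perms N \<Longrightarrow> inv_into UNIV w \<in> even_signed_perms N"
  by (simp add: even_signed_perms_def signed_perms_inv signature_inv)

lemma signed_perms_involutionI:
  assumes "\<And>x. w (w x) = x" "\<And>x. w (- x) = - w x" "\<And>x. x \<in> coords N \<Longrightarrow> w x \<in> coords N"
    "\<And>x. x \<notin> coords N \<Longrightarrow> w x = x"
  shows "w \<in> signed_perms N"
proof -
  have "w permutes coords N"
    unfolding permutes_def
  proof (intro conjI allI impI)
    show "\<exists>!x. w x = y" for y
      by (rule ex1I[of _ "w y"]) (use assms(1) in auto)
  qed (rule assms(4))
  then show ?thesis using assms(2) by (simp add: signed_perms_def)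
qed

text \<open>The reflection in the root \<open>e\<^sub>a + e\<^sub>b\<close>, where \<open>e\<^sub>-\<^sub>x = - e\<^sub>x\<close>.\<close>

definition reflect :: "int \<Rightarrow> int \<Rightarrow> int \<Rightarrow> int" where
  "reflect a b x = (if x = a then - b else if x = b then - a
     else if x = - a then b else if x = - b then a else x)"

definition root :: "nat \<Rightarrow> int \<Rightarrow> int \<Rightarrow> bool" where
  "root N a b \<longleftrightarrow> a \<in> coords N \<and> b \<in> coords N \<and> \<bar>a\<bar> \<noteq> \<bar>b\<bar>"

lemma rootD: "root N a b \<Longrightarrow> a \<noteq> 0 \<and> b \<noteq> 0 \<and> a \<noteq> b \<and> a \<noteq> - b \<and> b \<noteq> - a"
  by (auto simp: root_def coords_def)

lemma root_commute: "root N a b \<longleftrightarrow> root N b a"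
  by (auto simp: root_def)

lemma reflect_involutive: "root N a b \<Longrightarrow> reflect a b (reflect a b x) = x"
  by (drule rootD) (auto simp: reflect_def)

lemma reflect_uminus: "root N a b \<Longrightarrow> reflect a b (- x) = - reflect a b x"
  by (drule rootD) (auto simp: reflect_def)

lemma reflect_signed_perms: "root N a b \<Longrightarrow> reflect a b \<in> signed_perms N"
  by (rule signed_perms_involutionI, auto simp: reflect_involutive reflect_uminus)
    (auto simp: reflect_def root_def)

lemma reflect_even_signed_perms:
  assumes r: "root N a b"
  shows "reflect a b \<in> even_signed_perms N"
proof -
  have "signature N (reflect a b) = (\<Prod>x\<in>{\<bar>a\<bar>, \<bar>b\<bar>}. sgn (reflect a b x))"
    unfolding signature_def
    by (rule prod.mono_neutral_right)
      (use r in \<open>auto simp: reflect_def root_def coords_def\<close>)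
  also have "\<dots> = 1"
    using r by (auto simp: reflect_def root_def coords_def abs_if sgn_if split: if_splits)
  finally show ?thesis
    using reflect_signed_perms[OF r] by (simp add: even_signed_perms_def)
qed

lemma signed_perms_root: "w \<in> signed_perms N \<Longrightarrow> root N (w x) (w y) \<longleftrightarrow> root N x y"
  by (simp add: root_def signed_perms_abs_eq)

text \<open>The root \<open>e\<^sub>x + e\<^sub>y\<close> is positive if and only if \<open>x + y > 0\<close>. Roots are counted as
  ordered pairs, so \<open>inversions\<close> has twice as many elements as there are positive roots made
  negative by \<open>w\<close>.\<close>

definition inversions :: "nat \<Rightarrow> (int \<Rightarrow> int) \<Rightarrow> (int \<times> int) set" where
  "inversions N w = {(x, y). root N x y \<and> x + y > 0 \<and> w x + w y < 0}"

lemma finite_inversions: "finite (inversions N w)"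
  by (rule finite_subset[of _ "coords N \<times> coords N"]) (auto simp: inversions_def root_def finite_coords)

text \<open>The one property of a simple root that counting inversions needs, taken as the
  definition in place of indecomposability.\<close>

definition simple_root :: "nat \<Rightarrow> int \<Rightarrow> int \<Rightarrow> bool" where
  "simple_root N a b \<longleftrightarrow> root N a b \<and> a + b > 0 \<and>
     (\<forall>x y. root N x y \<and> x + y > 0 \<and> {x, y} \<noteq> {a, b} \<longrightarrow> reflect a b x + reflect a b y > 0)"

lemma signed_perms_sum_nz: "w \<in> signed_perms N \<Longrightarrow> root N x y \<Longrightarrow> w x + w y \<noteq> 0"
  using signed_perms_root[of w N x y] rootD[of N "w x" "w y"] by auto

text \<open>The reflection carries the old inversions to inversions of the product, and the only new
  one is its own root, which counts as the two ordered pairs \<open>(a, b)\<close> and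
  \<open>(b, a)\<close>.\<close>

lemma card_inversions_ascent:
  assumes w: "w \<in> signed_perms N" and s: "simple_root N a b" and pos: "w a + w b > 0"
  shows "card (inversions N (w \<circ> reflect a b)) = card (inversions N w) + 2"
proof -
  let ?r = "reflect a b" and ?T = "(\<lambda>(x, y). (reflect a b x, reflect a b y)) ` inversions N w"
  have r: "root N a b" and ab: "a + b > 0" using s by (simp_all add: simple_root_def)
  note rs = reflect_signed_perms[OF r]
  have ra: "?r a = - b" "?r b = - a" using rootD[OF r] by (auto simp: reflect_def)
  have eq: "inversions N (w \<circ> ?r) = ?T \<union> {(a, b), (b, a)}"
  proof (intro equalityI subrelI)
    fix x y assume xy: "(x, y) \<in> inversions N (w \<circ> ?r)"
    show "(x, y) \<in> ?T \<union> {(a, b), (b, a)}"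
    proof (cases "{x, y} = {a, b}")
      case True
      then show ?thesis by (auto simp: doubleton_eq_iff)
    next
      case False
      with xy s have "?r x + ?r y > 0" by (auto simp: inversions_def simple_root_def)
      with xy have "(?r x, ?r y) \<in> inversions N w"
        by (auto simp: inversions_def signed_perms_root[OF rs])
      then show ?thesis by (force simp: reflect_involutive[OF r])
    qed
  next
    fix x y assume xy: "(x, y) \<in> ?T \<union> {(a, b), (b, a)}"
    show "(x, y) \<in> inversions N (w \<circ> ?r)"
    proof (cases "(x, y) \<in> ?T")
      case True
      then obtain u v where uv: "(u, v) \<in> inversions N w" "x = ?r u" "y = ?r v" by auto
      then have "{u, v} \<noteq> {a, b}" using pos by (auto simp: inversions_def doubleton_eq_iff)
      with uv s have "x + y > 0" by (auto simp: inversions_def simple_root_def)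
      with uv show ?thesis
        by (auto simp: inversions_def signed_perms_root[OF rs] reflect_involutive[OF r])
    next
      case False
      with xy have "(x, y) = (a, b) \<or> (x, y) = (b, a)" by auto
      then show ?thesis using r ab pos
        by (auto simp: inversions_def root_commute[of N b a] ra signed_perms_uminus[OF w])
    qed
  qed
  \<comment> \<open>The reflection negates its own root, so a pair in \<open>?T\<close> made of
    \<open>a\<close> and \<open>b\<close> would be the negative of a positive root. Hence the two
    added pairs are new.\<close>
  have "x + y < 0" if "(x, y) \<in> ?T" "{x, y} = {a, b}" for x y
  proof -
    obtain u v where uv: "(u, v) \<in> inversions N w" "?r u = x" "?r v = y" using \<open>(x, y) \<in> ?T\<close> by auto
    then have "u = ?r x" "v = ?r y" using reflect_involutive[OF r] by auto
    with \<open>{x, y} = {a, b}\<close> ra ab uv(1) show ?thesis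
      by (auto simp: doubleton_eq_iff inversions_def)
  qed
  note negT = this
  have "(a, b) \<notin> ?T"
  proof
    assume "(a, b) \<in> ?T"
    from negT[OF this HOL.refl] ab show False by simp
  qed
  moreover have "(b, a) \<notin> ?T"
  proof
    assume "(b, a) \<in> ?T"
    from negT[OF this insert_commute] ab show False by simp
  qed
  moreover have "(a, b) \<noteq> (b, a)" using rootD[OF r] by simp
  moreover have "card ?T = card (inversions N w)"
    by (rule card_image) (auto simp: inj_on_def signed_perms_inj[OF rs])
  ultimately show ?thesis
    unfolding eq using finite_inversions[of N w] by (simp add: card_insert_if)
qed

lemma card_inversions_descent:
  assumes w: "w \<in> signed_perms N" and s: "simple_root N a b" and neg: "w a + w b < 0"
  shows "card (inversions N w) = card (inversions N (w \<circ> reflect a b)) + 2"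
proof -
  have r: "root N a b" using s by (simp add: simple_root_def)
  have "w (reflect a b a) + w (reflect a b b) > 0"
    using rootD[OF r] neg by (auto simp: reflect_def signed_perms_uminus[OF w])
  moreover have "w \<circ> reflect a b \<circ> reflect a b = w"
    by (rule ext) (simp add: reflect_involutive[OF r])
  ultimately show ?thesis
    using card_inversions_ascent[OF signed_perms_comp[OF w reflect_signed_perms[OF r]] s] by simp
qed

lemma inversions_id: "inversions N id = {}"
  by (auto simp: inversions_def)

text \<open>The hypotheses give \<open>w 2 > \<bar>w 1\<bar>\<close>. Counting up from there yields
  \<open>c \<le> w c\<close>, and counting down from \<open>int N\<close> yields
  \<open>w c \<le> c\<close>, for every \<open>c \<ge> 2\<close>. This leaves the sign of
  \<open>w 1\<close> open, which evenness settles.\<close>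

lemma even_signed_perms_no_descent:
  assumes w: "w \<in> even_signed_perms N" and N: "N \<ge> 2"
    and one: "w 1 + w 2 > 0" and asc: "\<And>c. 1 \<le> c \<Longrightarrow> c < int N \<Longrightarrow> w c < w (c + 1)"
  shows "w = id"
proof -
  have w': "w \<in> signed_perms N" using w by (rule even_signed_permsD)
  have asc_at_1: "w 1 < w 2" using asc[of 1] N by simp
  have abs_ge: "\<bar>w c\<bar> \<ge> c \<and> w c \<le> int N \<and> (c \<ge> 2 \<longrightarrow> w c > 0)" if "1 \<le> c" "c \<le> int N" for c
  proof -
    have "\<bar>w c\<bar> \<ge> c \<and> (c \<ge> 2 \<longrightarrow> w c > 0)" using that
    proof (induction c rule: int_ge_induct)
      case base
      have "w 1 \<in> coords N" using signed_perms_in[OF w'] N by (simp add: coords_def)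
      then show ?case by (auto simp: coords_def)
    next
      case (step c)
      then have "w c < w (c + 1)" using asc by simp
      moreover have "w 2 > \<bar>w 1\<bar>" using one asc_at_1 by simp
      ultimately show ?case using step by (cases "c = 1") auto
    qed
    moreover have "c \<in> coords N" using that by (auto simp: coords_def)
    then have "w c \<in> coords N" using signed_perms_in[OF w'] by simp
    then have "w c \<le> int N" by (auto simp: coords_def)
    ultimately show ?thesis by simp
  qed
  have top: "w c \<le> c" if "c \<le> int N" "1 \<le> c" for c
    using that
  proof (induction c rule: int_le_induct)
    case base
    then show ?case using abs_ge[of "int N"] by simp
  next
    case (step c)
    then show ?case using asc[of "c - 1"] by auto
  qed
  have ge2: "w c = c" if "2 \<le> c" "c \<le> int N" for c
    using abs_ge[of c] top[of c] that by auto
  have "signature N w = (\<Prod>x\<in>{1}. sgn (w x))"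
    unfolding signature_def
    by (rule prod.mono_neutral_right) (use N ge2 in \<open>auto simp: sgn_if\<close>)
  then have "w 1 > 0" using w by (auto simp: even_signed_perms_def sgn_if split: if_splits)
  then have one': "w 1 = 1" using abs_ge[of 1] top[of 1] N by simp
  have pos: "w c = c" if "1 \<le> c" "c \<le> int N" for c
    using that ge2 one' by (cases "c = 1") auto
  have "w x = x" for x
  proof (cases "x \<in> coords N")
    case True
    then show ?thesis using pos[of x] pos[of "- x"] signed_perms_uminus[OF w', of x]
      by (cases "x > 0") (auto simp: coords_def)
  qed (use signed_perms_fix[OF w'] in auto)
  then show ?thesis by auto
qed

section \<open>Reduced words\<close>

lemma simple_root_adjacent:
  assumes "1 \<le> c" "c < int N"
  shows "simple_root N (- c) (c + 1)"
proof -
  have r: "root N (- c) (c + 1)" using assms by (auto simp: root_def coords_def)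
  have "reflect (- c) (c + 1) x + reflect (- c) (c + 1) y > 0"
    if "root N x y" "x + y > 0" "{x, y} \<noteq> {- c, c + 1}" for x y
    using rootD[OF that(1)] that(2,3) assms(1)
    by (auto simp: reflect_def doubleton_eq_iff split: if_splits)
  with r assms show ?thesis by (simp add: simple_root_def)
qed

lemma simple_root_fork:
  assumes "N \<ge> 2"
  shows "simple_root N 1 2"
proof -
  have r: "root N 1 2" using assms by (auto simp: root_def coords_def)
  have "reflect 1 2 x + reflect 1 2 y > 0"
    if "root N x y" "x + y > 0" "{x, y} \<noteq> {1, 2}" for x y
    using rootD[OF that(1)] that(2,3)
    by (auto simp: reflect_def doubleton_eq_iff split: if_splits)
  with r show ?thesis by (simp add: simple_root_def)
qed

lemma reflect_sym: "root N a b \<Longrightarrow> reflect a b = reflect b a"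
  by (drule rootD) (auto simp: reflect_def fun_eq_iff)

text \<open>Conjugation carries the reflection in a root to the reflection in the image root. The
  commutation and braid relations are read off from this.\<close>

lemma reflect_conj:
  assumes w: "w \<in> signed_perms N" and r: "root N a b"
  shows "w \<circ> reflect a b = reflect (w a) (w b) \<circ> w"
proof
  fix x
  have "w x = w a \<longleftrightarrow> x = a" "w x = w b \<longleftrightarrow> x = b" "w x = - w a \<longleftrightarrow> x = - a" "w x = - w b \<longleftrightarrow> x = - b"
    using signed_perms_inj[OF w] signed_perms_uminus[OF w] by metis+
  then show "(w \<circ> reflect a b) x = (reflect (w a) (w b) \<circ> w) x"
    by (auto simp: reflect_def signed_perms_uminus[OF w])
qed

lemma reflect_commute_disjoint:
  assumes "root N a b" "root N c d" "\<bar>a\<bar> \<noteq> \<bar>c\<bar>" "\<bar>a\<bar> \<noteq> \<bar>d\<bar>" "\<bar>b\<bar> \<noteq> \<bar>c\<bar>" "\<bar>b\<bar> \<noteq> \<bar>d\<bar>"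
  shows "reflect a b \<circ> reflect c d = reflect c d \<circ> reflect a b"
proof -
  have "reflect a b c = c" "reflect a b d = d" using assms(3-6) by (auto simp: reflect_def)
  then show ?thesis using reflect_conj[OF reflect_signed_perms[OF assms(1)] assms(2)] by simp
qed

lemma reflect_commute_orthogonal:
  assumes "root N a b"
  shows "reflect a b \<circ> reflect (- a) b = reflect (- a) b \<circ> reflect a b"
proof -
  have r: "root N (- a) b" using assms by (simp add: root_def)
  have "reflect a b (- a) = b" "reflect a b b = - a" using rootD[OF assms] by (auto simp: reflect_def)
  then show ?thesis
    using reflect_conj[OF reflect_signed_perms[OF assms] r] reflect_sym[OF r] by simp
qed

text \<open>Both sides equal \<open>reflect x z\<close>, the reflection in the sum of the two
  roots.\<close>

lemma reflect_braid:
  assumes xy: "root N x y" and yz: "root N (- y) z" and xz: "\<bar>x\<bar> \<noteq> \<bar>z\<bar>"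
  shows "reflect x y \<circ> reflect (- y) z \<circ> reflect x y
    = reflect (- y) z \<circ> reflect x y \<circ> reflect (- y) z"
proof -
  let ?s = "reflect x y" and ?t = "reflect (- y) z"
  have ss: "?s \<circ> ?s = id" and tt: "?t \<circ> ?t = id"
    by (auto simp: fun_eq_iff reflect_involutive[OF xy] reflect_involutive[OF yz])
  have "?s (- y) = x" "?s z = z" "?t x = x" "?t y = z"
    using rootD[OF xy] rootD[OF yz] xz by (auto simp: reflect_def)
  then have "?s \<circ> ?t = reflect x z \<circ> ?s" "?t \<circ> ?s = reflect x z \<circ> ?t"
    using reflect_conj[OF reflect_signed_perms[OF xy] yz] reflect_conj[OF reflect_signed_perms[OF yz] xy]
    by simp_all
  then have "?s \<circ> ?t \<circ> ?s = reflect x z" "?t \<circ> ?s \<circ> ?t = reflect x z"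
    by (simp_all add: comp_assoc ss tt)
  then show ?thesis by simp
qed

text \<open>Reversing the coordinates, \<open>c = n + 1 - i\<close> for the node \<open>i\<close>, makes the simple roots
  \<open>e\<^sub>c\<^sub>+\<^sub>1 - e\<^sub>c\<close> for \<open>i \<le> n\<close> and \<open>e\<^sub>1 + e\<^sub>2\<close> for \<open>i = n + 1\<close>, so that \<open>J_set n l\<close> acts on the
  coordinates \<open>1, \<dots>, l + 1\<close>.\<close>

definition lo :: "nat \<Rightarrow> nat \<Rightarrow> int" where
  "lo n i = (if i = n + 1 then 1 else int i - int n - 1)"

definition hi :: "nat \<Rightarrow> nat \<Rightarrow> int" where
  "hi n i = (if i = n + 1 then 2 else int n + 2 - int i)"

definition node_perm :: "nat \<Rightarrow> nat \<Rightarrow> int \<Rightarrow> int" where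
  "node_perm n i = reflect (lo n i) (hi n i)"

definition word_perm :: "nat \<Rightarrow> nat list \<Rightarrow> int \<Rightarrow> int" where
  "word_perm n u = foldr (\<lambda>i f. node_perm n i \<circ> f) u id"

lemma word_perm_simps [simp]:
  "word_perm n [] = id" "word_perm n (i # u) = node_perm n i \<circ> word_perm n u"
  by (simp_all add: word_perm_def)

lemma word_perm_append: "word_perm n (u @ v) = word_perm n u \<circ> word_perm n v"
  by (induction u) (simp_all add: comp_assoc)

lemma word_perm_snoc: "word_perm n (u @ [i]) = word_perm n u \<circ> node_perm n i"
  by (simp add: word_perm_append)

section \<open>Commutation and braid relations between words\<close>

lemma coxeter_cong_append:
  assumes "coxeter_cong S m u u'" "coxeter_cong S m v v'"
  shows "coxeter_cong S m (u @ v) (u' @ v')"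
proof -
  have "coxeter_cong S m (u @ v) (u' @ v)"
    using coxeter_cong_context[OF assms(1), of "[]" v] coxeter_cong_lists[OF assms(2)] by simp
  moreover have "coxeter_cong S m (u' @ v) (u' @ v')"
    using coxeter_cong_context[OF assms(2), of u' "[]"] coxeter_cong_lists[OF assms(1)] by simp
  ultimately show ?thesis by (rule coxeter_cong.trans)
qed

lemma coxeter_cong_gen_gen:
  assumes "coxeter_matrix S m" "i \<in> S"
  shows "coxeter_cong S m [i, i] []"
proof -
  have "m i i = 1" using assms by (auto simp: coxeter_matrix_def)
  then show ?thesis using coxeter_cong.rel[of i S i "[]" "[]" m] assms by simp
qed

lemma coxeter_cong_rev:
  assumes M: "coxeter_matrix S m" and "u \<in> lists S"
  shows "coxeter_cong S m (u @ rev u) []"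
  using assms(2)
proof (induction u)
  case Nil
  then show ?case by (simp add: coxeter_cong.refl)
next
  case (Cons i u)
  then have i: "i \<in> S" by simp
  have "coxeter_cong S m ([i] @ (u @ rev u) @ [i]) ([i] @ [] @ [i])"
    by (rule coxeter_cong_context) (use Cons i in auto)
  with coxeter_cong_gen_gen[OF M i] show ?case by (auto intro: coxeter_cong.trans)
qed

text \<open>The generators are involutions, so \<open>rev v\<close> represents the inverse of
  \<open>v\<close>. This turns the defining relations into their commutation and braid
  forms.\<close>

lemma coxeter_cong_move:
  assumes M: "coxeter_matrix S m" and uv: "coxeter_cong S m (u @ v) []"
  shows "coxeter_cong S m u (rev v)"
proof -
  have S: "u \<in> lists S" "v \<in> lists S" "rev v \<in> lists S" using coxeter_cong_lists[OF uv] by auto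
  have "coxeter_cong S m (u @ (v @ rev v)) (u @ [])"
    by (rule coxeter_cong_append[OF coxeter_cong.refl[OF S(1)] coxeter_cong_rev[OF M S(2)]])
  moreover have "coxeter_cong S m ((u @ v) @ rev v) ([] @ rev v)"
    by (rule coxeter_cong_append[OF uv coxeter_cong.refl[OF S(3)]])
  ultimately show ?thesis
    using coxeter_cong.trans[OF coxeter_cong.sym] by fastforce
qed

lemma coxeter_cong_commute:
  assumes "coxeter_matrix S m" "i \<in> S" "j \<in> S" "m i j = 2"
  shows "coxeter_cong S m [i, j] [j, i]"
  using coxeter_cong_move[of S m "[i, j]" "[i, j]"] coxeter_cong.rel[of i S j "[]" "[]" m] assms
  by (simp add: numeral_2_eq_2)

lemma coxeter_cong_braid:
  assumes "coxeter_matrix S m" "i \<in> S" "j \<in> S" "m i j = 3"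
  shows "coxeter_cong S m [i, j, i] [j, i, j]"
  using coxeter_cong_move[of S m "[i, j, i]" "[j, i, j]"] coxeter_cong.rel[of i S j "[]" "[]" m] assms
  by (simp add: numeral_3_eq_3)

lemma D_edges_iff:
  "(i, j) \<in> D_edges n \<longleftrightarrow> 1 \<le> i \<and> j = i + 1 \<and> j \<le> n - 1 \<or> i = n - 1 \<and> (j = n \<or> j = n + 1)"
  by (auto simp: D_edges_def)

lemma D_matrix_cases: "D_matrix n i j = 1 \<or> D_matrix n i j = 2 \<or> D_matrix n i j = 3"
  by (simp add: D_matrix_def)

section \<open>Simple reflections of type D as signed permutations\<close>

locale type_D =
  fixes n :: nat
  assumes n3: "n \<ge> 3"
begin

abbreviation N :: nat where "N \<equiv> Suc n"

abbreviation S :: "nat set" where "S \<equiv> D_nodes n"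

abbreviation cong_D :: "nat list \<Rightarrow> nat list \<Rightarrow> bool" (infix "\<approx>" 50) where
  "u \<approx> v \<equiv> coxeter_cong S (D_matrix n) u v"

abbreviation descent :: "(int \<Rightarrow> int) \<Rightarrow> nat \<Rightarrow> bool" where
  "descent w i \<equiv> w (lo n i) + w (hi n i) < 0"

lemma simple_root_node:
  assumes "i \<in> S"
  shows "simple_root N (lo n i) (hi n i)"
proof (cases "i = n + 1")
  case True
  then show ?thesis using simple_root_fork[of N] n3 by (simp add: lo_def hi_def)
next
  case False
  then have "simple_root N (- (int n + 1 - int i)) (int n + 1 - int i + 1)"
    using assms by (intro simple_root_adjacent) (auto simp: D_nodes_def)
  moreover have "- (int n + 1 - int i) = lo n i" "int n + 1 - int i + 1 = hi n i"
    using False by (auto simp: lo_def hi_def)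
  ultimately show ?thesis by metis
qed

lemma root_node: "i \<in> S \<Longrightarrow> root N (lo n i) (hi n i)"
  using simple_root_node by (simp add: simple_root_def)

lemma node_perm_even: "i \<in> S \<Longrightarrow> node_perm n i \<in> even_signed_perms N"
  by (simp add: node_perm_def reflect_even_signed_perms root_node)

lemma node_perm_involutive: "i \<in> S \<Longrightarrow> node_perm n i \<circ> node_perm n i = id"
  using reflect_involutive[OF root_node] by (auto simp: node_perm_def fun_eq_iff)

lemma word_perm_even: "u \<in> lists S \<Longrightarrow> word_perm n u \<in> even_signed_perms N"
  by (induction u) (auto simp: even_signed_perms_id intro!: even_signed_perms_comp node_perm_even)

text \<open>The two ends of the fork, \<open>n\<close> and \<open>n + 1\<close>, have orthogonal
  roots on the same two coordinates; any other two commuting nodes act on disjoint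
  coordinates.\<close>

lemma node_perm_commute:
  assumes ij: "i \<in> S" "j \<in> S" and m: "D_matrix n i j = 2"
  shows "node_perm n i \<circ> node_perm n j = node_perm n j \<circ> node_perm n i"
proof -
  have *: "node_perm n i \<circ> node_perm n j = node_perm n j \<circ> node_perm n i"
    if ij: "i \<in> S" "j \<in> S" and m: "D_matrix n i j = 2" and lt: "i < j" for i j
  proof (cases "i = n \<and> j = n + 1")
    case True
    then have "lo n i = - lo n j" "hi n i = hi n j" by (auto simp: lo_def hi_def)
    then show ?thesis
      using reflect_commute_orthogonal[OF root_node[OF ij(2)]] by (simp add: node_perm_def)
  next
    case False
    have "(i, j) \<notin> D_edges n" "i \<noteq> j" using m by (auto simp: D_matrix_def split: if_splits)
    with False lt ij have "j = n + 1 \<and> i + 1 < n \<or> i + 1 < j \<and> j \<le> n"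
      using n3 by (auto simp: D_edges_def D_nodes_def)
    then show ?thesis unfolding node_perm_def
      by (intro reflect_commute_disjoint[OF root_node[OF ij(1)] root_node[OF ij(2)]])
        (auto simp: lo_def hi_def)
  qed
  have "i \<noteq> j" "D_matrix n j i = 2" using m by (auto simp: D_matrix_def split: if_splits)
  then show ?thesis using *[of i j] *[of j i] ij m by (cases "i < j") auto
qed

text \<open>The simple roots of adjacent nodes are \<open>e\<^sub>x + e\<^sub>y\<close> and \<open>e\<^sub>-\<^sub>y + e\<^sub>z\<close>, with sum the root \<open>e\<^sub>x + e\<^sub>z\<close>.\<close>

lemma adjacent_nodes:
  assumes ij: "i \<in> S" "j \<in> S" and m: "D_matrix n i j = 3"
  obtains x y z where "root N x y" "root N (- y) z" "\<bar>x\<bar> \<noteq> \<bar>z\<bar>"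
    "node_perm n i = reflect x y" "node_perm n j = reflect (- y) z"
    "\<And>w. descent w i \<longleftrightarrow> w x + w y < 0" "\<And>w. descent w j \<longleftrightarrow> w (- y) + w z < 0"
proof -
  define adj where "adj i j x y z \<longleftrightarrow> root N x y \<and> root N (- y) z \<and> \<bar>x\<bar> \<noteq> \<bar>z\<bar> \<and>
    node_perm n i = reflect x y \<and> node_perm n j = reflect (- y) z \<and>
    (\<forall>w. descent w i \<longleftrightarrow> w x + w y < 0) \<and> (\<forall>w. descent w j \<longleftrightarrow> w (- y) + w z < 0)" for i j x y z
  have sym: "adj j i z (- y) x" if "adj i j x y z" for i j x y z
    using that reflect_sym[of N x y] reflect_sym[of N "- y" z]
    by (auto simp: adj_def root_commute add.commute)
  have "\<exists>x y z. adj i j x y z" if e: "(i, j) \<in> D_edges n" and ij: "i \<in> S" "j \<in> S" for i j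
  proof (cases "j = n + 1")
    case True
    then have i: "i = n - 1" using e by (auto simp: D_edges_def)
    then have "lo n i = - 2" "hi n i = 3" "lo n j = 1" "hi n j = 2"
      using True n3 by (auto simp: lo_def hi_def)
    moreover from this have "root N (- 2) 3" "root N 1 2" using root_node ij by metis+
    \<comment> \<open>At the fork the roots are \<open>e3 - e2\<close> and \<open>e2 + e1\<close>,
      with sum \<open>e3 + e1\<close>.\<close>
    ultimately have "adj i j 3 (- 2) 1"
      using reflect_sym[of N "- 2" 3] reflect_sym[of N 1 2]
      by (auto simp: adj_def node_perm_def root_commute add.commute)
    then show ?thesis by blast
  next
    case False
    then have "j = i + 1" "j \<le> n" using e n3 by (auto simp: D_edges_def)
    define h where "h = hi n j"
    have *: "lo n i = - h" "hi n i = h + 1" "lo n j = 1 - h" "hi n j = h" "h \<ge> 2"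
      using \<open>j = i + 1\<close> \<open>j \<le> n\<close> by (auto simp: lo_def hi_def h_def)
    have r: "root N (- h) (h + 1)" "root N (1 - h) h" using root_node[OF ij(1)] root_node[OF ij(2)] * by simp_all
    have "adj i j (h + 1) (- h) (1 - h)"
      unfolding adj_def node_perm_def *
    proof (intro conjI allI)
      show "root N (h + 1) (- h)" using r(1) by (subst root_commute)
      show "root N (- (- h)) (1 - h)" using r(2) by (subst root_commute) simp
      show "\<bar>h + 1\<bar> \<noteq> \<bar>1 - h\<bar>" using \<open>h \<ge> 2\<close> by arith
      show "reflect (- h) (h + 1) = reflect (h + 1) (- h)" "reflect (1 - h) h = reflect (- (- h)) (1 - h)"
        using reflect_sym[OF r(1)] reflect_sym[OF r(2)] by simp_all
    qed (simp_all add: add.commute)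
    then show ?thesis by blast
  qed
  moreover have "(i, j) \<in> D_edges n \<or> (j, i) \<in> D_edges n"
    using m by (auto simp: D_matrix_def split: if_splits)
  ultimately obtain x y z where "adj i j x y z" using sym ij by blast
  then show ?thesis using that by (auto simp: adj_def)
qed

lemma node_perm_braid:
  assumes "i \<in> S" "j \<in> S" "D_matrix n i j = 3"
  shows "node_perm n i \<circ> node_perm n j \<circ> node_perm n i = node_perm n j \<circ> node_perm n i \<circ> node_perm n j"
  by (rule adjacent_nodes[OF assms]) (simp add: reflect_braid)

lemma card_inversions_node_ascent:
  assumes "w \<in> signed_perms N" "i \<in> S" "\<not> descent w i"
  shows "card (inversions N (w \<circ> node_perm n i)) = card (inversions N w) + 2"
  unfolding node_perm_def
  using card_inversions_ascent[OF assms(1) simple_root_node[OF assms(2)]] assms(3)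
    signed_perms_sum_nz[OF assms(1) root_node[OF assms(2)]] by linarith

lemma card_inversions_node_descent:
  assumes "w \<in> signed_perms N" "i \<in> S" "descent w i"
  shows "card (inversions N w) = card (inversions N (w \<circ> node_perm n i)) + 2"
  unfolding node_perm_def
  using card_inversions_descent[OF assms(1) simple_root_node[OF assms(2)]] assms(3) by simp

lemma card_inversions_word_perm: "u \<in> lists S \<Longrightarrow> card (inversions N (word_perm n u)) \<le> 2 * length u"
proof (induction u rule: rev_induct)
  case Nil
  then show ?case by (simp add: inversions_id[unfolded id_def] id_def)
next
  case (snoc i u)
  then have i: "i \<in> S" "u \<in> lists S" by auto
  then have w: "word_perm n u \<in> signed_perms N" using word_perm_even even_signed_permsD by blast
  have "card (inversions N (word_perm n u \<circ> node_perm n i)) \<le> 2 * length u + 2"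
    using card_inversions_node_ascent[OF w i(1)] card_inversions_node_descent[OF w i(1)] snoc.IH[OF i(2)]
    by (cases "descent (word_perm n u) i") linarith+
  then show ?case by (simp only: word_perm_snoc length_append_singleton mult_Suc_right)
qed

text \<open>If the nodes commute, the reflection of \<open>i\<close> fixes the simple root of
  \<open>j\<close>. If they are adjacent, it sends that root to the sum of both simple roots, which
  \<open>w\<close> makes negative because it makes each of them negative.\<close>

lemma descent_comp_node:
  assumes w: "w \<in> signed_perms N" and ij: "i \<in> S" "j \<in> S" and d: "descent w i" "descent w j"
    and m: "D_matrix n i j \<noteq> 1"
  shows "descent (w \<circ> node_perm n i) j"
proof (cases "D_matrix n i j = 2")
  case True
  define a b where "a = lo n j" "b = hi n j"
  have "{node_perm n i a, node_perm n i b} = {a, b}"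
  proof -
    have "i \<noteq> j" "(i, j) \<notin> D_edges n" "(j, i) \<notin> D_edges n"
      using True by (auto simp: D_matrix_def split: if_splits)
    then have e: "\<not> (j = i + 1 \<and> j \<le> n - 1)" "\<not> (i = j + 1 \<and> i \<le> n - 1)"
      "i = n - 1 \<Longrightarrow> j \<noteq> n \<and> j \<noteq> n + 1" "j = n - 1 \<Longrightarrow> i \<noteq> n \<and> i \<noteq> n + 1"
      and S: "1 \<le> i" "i \<le> n + 1" "1 \<le> j" "j \<le> n + 1"
      using ij by (simp_all add: D_edges_iff D_nodes_def)
    have "i = n + 1 \<and> j = n \<or> i = n \<and> j = n + 1 \<or> i = n + 1 \<and> j + 1 < n \<or> j = n + 1 \<and> i + 1 < n
        \<or> i \<le> n \<and> j \<le> n \<and> (i + 1 < j \<or> j + 1 < i)"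
    proof -
      consider "i = n + 1" | "j = n + 1" | "i \<le> n" "j \<le> n" using S by linarith
      then show ?thesis
      proof cases
        case 1
        then have "j = n \<or> j + 1 < n" using e(4) S(4) \<open>i \<noteq> j\<close> by (cases "j = n - 1") auto
        with 1 show ?thesis by blast
      next
        case 2
        then have "i = n \<or> i + 1 < n" using e(3) S(2) \<open>i \<noteq> j\<close> by (cases "i = n - 1") auto
        with 2 show ?thesis by blast
      next
        case 3
        have "j \<noteq> i + 1" using e(1) e(3) 3 n3 by (cases "i = n - 1") auto
        moreover have "i \<noteq> j + 1" using e(2) e(4) 3 n3 by (cases "j = n - 1") auto
        ultimately show ?thesis using 3 \<open>i \<noteq> j\<close> by auto
      qed
    qed
    then show ?thesis
      by (elim disjE; use n3 in \<open>auto simp: a_b_def node_perm_def reflect_def lo_def hi_def insert_commute\<close>)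
  qed
  then have "w (node_perm n i a) + w (node_perm n i b) = w a + w b"
    by (auto simp: doubleton_eq_iff)
  then show ?thesis using d(2) by (simp add: a_b_def)
next
  case False
  then have "D_matrix n i j = 3" using m D_matrix_cases[of n i j] by auto
  from adjacent_nodes[OF ij this] obtain x y z where xyz: "root N x y" "root N (- y) z" "\<bar>x\<bar> \<noteq> \<bar>z\<bar>"
    "node_perm n i = reflect x y" "node_perm n j = reflect (- y) z"
    "\<And>w. descent w i \<longleftrightarrow> w x + w y < 0" "\<And>w. descent w j \<longleftrightarrow> w (- y) + w z < 0" by metis
  have "reflect x y (- y) = x" "reflect x y z = z"
    using rootD[OF xyz(1)] rootD[OF xyz(2)] xyz(3) by (auto simp: reflect_def)
  moreover have "w x + w y < 0" "- w y + w z < 0"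
    using d xyz(6,7) signed_perms_uminus[OF w] by auto
  ultimately have "(w \<circ> node_perm n i) (- y) + (w \<circ> node_perm n i) z < 0"
    by (simp add: xyz(4))
  then show ?thesis using xyz(7)[of "w \<circ> node_perm n i"] by blast
qed

section \<open>Reduced words and Matsumoto's theorem\<close>

lemma no_descent_id:
  assumes w: "w \<in> even_signed_perms N" and "\<And>i. i \<in> S \<Longrightarrow> \<not> descent w i"
  shows "w = id"
proof (rule even_signed_perms_no_descent[OF w])
  have w': "w \<in> signed_perms N" using w by (rule even_signed_permsD)
  have pos: "w (lo n i) + w (hi n i) > 0" if "i \<in> S" for i
    using assms(2)[OF that] signed_perms_sum_nz[OF w' root_node[OF that]] by linarith
  show "w 1 + w 2 > 0" using pos[of "n + 1"] by (simp add: lo_def hi_def D_nodes_def)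
  fix c :: int assume c: "1 \<le> c" "c < int N"
  have "nat (int n + 1 - c) \<in> S" using c by (auto simp: D_nodes_def)
  from pos[OF this] have "w (- c) + w (c + 1) > 0" using c by (simp add: lo_def hi_def nat_eq_iff add.commute)
  then show "w c < w (c + 1)" using signed_perms_uminus[OF w'] by simp
qed (use n3 in simp)

text \<open>Measured by inversions rather than by minimal length, so that it is available before
  faithfulness is known; \<open>elt_length\<close> identifies the two notions later.\<close>

definition reduced_word :: "(int \<Rightarrow> int) \<Rightarrow> nat list \<Rightarrow> bool" where
  "reduced_word w u \<longleftrightarrow> u \<in> lists S \<and> word_perm n u = w \<and> 2 * length u = card (inversions N w)"

lemma reduced_word_snoc:
  assumes w: "w \<in> signed_perms N" and i: "i \<in> S" and d: "descent w i"
  shows "reduced_word w (u @ [i]) \<longleftrightarrow> reduced_word (w \<circ> node_perm n i) u"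
proof -
  have "word_perm n u \<circ> node_perm n i = w \<longleftrightarrow> word_perm n u = w \<circ> node_perm n i"
    by (metis comp_assoc comp_id i node_perm_involutive)
  then show ?thesis
    using card_inversions_node_descent[OF w i d] i
    by (auto simp: reduced_word_def word_perm_append)
qed

lemma reduced_word_exists: "w \<in> even_signed_perms N \<Longrightarrow> \<exists>u. reduced_word w u"
proof (induction "card (inversions N w)" arbitrary: w rule: less_induct)
  case less
  note w' = even_signed_permsD[OF less.prems]
  show ?case
  proof (cases "\<exists>i\<in>S. descent w i")
    case True
    then obtain i where i: "i \<in> S" "descent w i" by blast
    then have "w \<circ> node_perm n i \<in> even_signed_perms N"
      by (intro even_signed_perms_comp less.prems node_perm_even)
    then obtain u where "reduced_word (w \<circ> node_perm n i) u"
      using less.hyps card_inversions_node_descent[OF w' i] by force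
    then show ?thesis using reduced_word_snoc[OF w' i] by blast
  next
    case False
    then have "w = id" using no_descent_id[OF less.prems] by blast
    then have "reduced_word w []" by (simp add: reduced_word_def inversions_id)
    then show ?thesis by blast
  qed
qed

lemma reduced_word_lists: "reduced_word w u \<Longrightarrow> u \<in> lists S"
  by (simp add: reduced_word_def)

text \<open>Matsumoto's theorem: if two reduced words end in \<open>i\<close> and \<open>j\<close>, then the element also has
  reduced words ending in the two sides of the braid relation between \<open>i\<close> and \<open>j\<close>.\<close>

lemma reduced_word_unique:
  "w \<in> even_signed_perms N \<Longrightarrow> reduced_word w u \<Longrightarrow> reduced_word w v \<Longrightarrow> u \<approx> v"
proof (induction "card (inversions N w)" arbitrary: w u v rule: less_induct)
  case less
  note w = less.prems(1) and w' = even_signed_permsD[OF less.prems(1)]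
  note M = coxeter_matrix_D[of n]
  have len: "length u = length v" using less.prems by (simp add: reduced_word_def)
  show ?case
  proof (cases u rule: rev_cases)
    case Nil
    then show ?thesis using len by (simp add: coxeter_cong.refl)
  next
    case (snoc u' i)
    then obtain v' j where v: "v = v' @ [j]" using len by (cases v rule: rev_cases) auto
    have S: "i \<in> S" "j \<in> S" using less.prems(2,3) snoc v by (auto simp: reduced_word_def)
    have even: "w \<circ> node_perm n i \<in> even_signed_perms N" if "w \<in> even_signed_perms N" "i \<in> S" for w i
      using that by (intro even_signed_perms_comp node_perm_even)
    \<comment> \<open>If the last letter were an ascent, deleting it would leave a word too short
      for its number of inversions.\<close>
    have desc: "descent w k" if "reduced_word w (t @ [k])" "k \<in> S" for t k
    proof (rule ccontr)
      assume nd: "\<not> descent w k"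
      have "word_perm n t = w \<circ> node_perm n k"
        using that by (metis comp_assoc comp_id node_perm_involutive reduced_word_def word_perm_append word_perm_simps)
      moreover have "2 * length t + 2 = card (inversions N w)"
        using that(1) by (simp add: reduced_word_def)
      moreover have "card (inversions N (word_perm n t)) \<le> 2 * length t"
        using that(1) card_inversions_word_perm by (auto simp: reduced_word_def)
      ultimately show False using card_inversions_node_ascent[OF w' that(2) nd] by simp
    qed
    have d: "descent w i" "descent w j" using desc S less.prems(2,3) snoc v by blast+
    have ri: "reduced_word (w \<circ> node_perm n i) u'" using reduced_word_snoc[OF w' S(1) d(1)] less.prems(2) snoc by simp
    have rj: "reduced_word (w \<circ> node_perm n j) v'" using reduced_word_snoc[OF w' S(2) d(2)] less.prems(3) v by simp
    have IH: "x \<approx> y" if "k \<in> S" "descent w k" "reduced_word (w \<circ> node_perm n k) x"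
        "reduced_word (w \<circ> node_perm n k) y" for x y k
      using less.hyps[of "w \<circ> node_perm n k" x y] card_inversions_node_descent[OF w' that(1,2)] even[OF w that(1)] that
      by simp
    have refl1: "[k] \<approx> [k]" if "k \<in> S" for k using that by (simp add: coxeter_cong.refl)
    note snoc_desc = reduced_word_snoc[OF even_signed_permsD]
    have sym: "D_matrix n j i = D_matrix n i j" by (auto simp: D_matrix_def)
    consider "D_matrix n i j = 1" | "D_matrix n i j = 2" | "D_matrix n i j = 3"
      using D_matrix_cases by blast
    then show ?thesis
    proof cases
      case 1
      then have "i = j" by (auto simp: D_matrix_def split: if_splits)
      then have "u' \<approx> v'" using IH[OF S(1) d(1) ri] rj by simp
      then show ?thesis using coxeter_cong_append[OF _ refl1[OF S(1)]] snoc v \<open>i = j\<close> by blast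
    next
      case 2
      have dij: "descent (w \<circ> node_perm n i) j" using descent_comp_node[OF w' S d] 2 by simp
      have dji: "descent (w \<circ> node_perm n j) i" using descent_comp_node[OF w' S(2,1) d(2,1)] 2 sym by simp
      \<comment> \<open>The common prefix: \<open>u\<close> and \<open>v\<close> are compared with
        \<open>r @ [j, i]\<close> and \<open>r @ [i, j]\<close>, using the induction hypothesis on
        each side after removing the last letter.\<close>
      obtain r where r: "reduced_word (w \<circ> node_perm n i \<circ> node_perm n j) r"
        using reduced_word_exists even w S by blast
      then have r': "reduced_word (w \<circ> node_perm n j \<circ> node_perm n i) r"
        using node_perm_commute[OF S 2] by (simp add: comp_assoc)
      have "u' \<approx> r @ [j]" using IH[OF S(1) d(1) ri] r snoc_desc[OF even[OF w S(1)] S(2) dij] by blast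
      then have "u \<approx> (r @ [j]) @ [i]" using coxeter_cong_append refl1[OF S(1)] snoc by blast
      moreover have "v' \<approx> r @ [i]" using IH[OF S(2) d(2) rj] r' snoc_desc[OF even[OF w S(2)] S(1) dji] by blast
      then have "v \<approx> (r @ [i]) @ [j]" using coxeter_cong_append refl1[OF S(2)] v by blast
      moreover have "r @ [i, j] \<approx> r @ [j, i]"
        using coxeter_cong_append[OF coxeter_cong.refl[OF reduced_word_lists[OF r]] coxeter_cong_commute[OF M S 2]] .
      ultimately show ?thesis by (simp, meson coxeter_cong.sym coxeter_cong.trans)
    next
      case 3
      let ?i = "node_perm n i" and ?j = "node_perm n j"
      have dij: "descent (w \<circ> ?i) j" using descent_comp_node[OF w' S d] 3 by simp
      have dji: "descent (w \<circ> ?j) i" using descent_comp_node[OF w' S(2,1) d(2,1)] 3 sym by simp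
      from adjacent_nodes[OF S 3] obtain x y z where xyz: "root N x y" "root N (- y) z" "\<bar>x\<bar> \<noteq> \<bar>z\<bar>"
        "?i = reflect x y" "?j = reflect (- y) z"
        "\<And>w. descent w i \<longleftrightarrow> w x + w y < 0" "\<And>w. descent w j \<longleftrightarrow> w (- y) + w z < 0" by metis
      have vals: "?i x = - y" "?i y = - x" "?i z = z" "?i (- y) = x" "?j (- y) = - z" "?j z = y" "?j x = x" "?j y = z"
        "?j (- z) = - y" "?i (- x) = y" "?i (- z) = - z"
        using rootD[OF xyz(1)] rootD[OF xyz(2)] xyz(3) by (auto simp: reflect_def xyz(4,5))
      have dw: "w x + w y < 0" "w (- y) + w z < 0" using d xyz(6,7) by blast+
      \<comment> \<open>The product \<open>?i \<circ> ?j\<close> sends the simple root of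
        \<open>i\<close> to that of \<open>j\<close>, so this is the descent of \<open>w\<close> at
        \<open>j\<close>; the next fact is symmetric.\<close>
      have diji: "descent (w \<circ> ?i \<circ> ?j) i"
        unfolding xyz(6) using dw by (simp add: vals add.commute)
      have djij: "descent (w \<circ> ?j \<circ> ?i) j"
        unfolding xyz(7) using dw by (simp add: vals add.commute)
      obtain r where r: "reduced_word (w \<circ> ?i \<circ> ?j \<circ> ?i) r"
        using reduced_word_exists even w S by blast
      then have r': "reduced_word (w \<circ> ?j \<circ> ?i \<circ> ?j) r"
        using node_perm_braid[OF S 3] by (simp add: comp_assoc)
      have "reduced_word (w \<circ> ?i) ((r @ [i]) @ [j])"
        using r snoc_desc[OF even[OF w S(1)] S(2) dij] snoc_desc[OF even[OF even[OF w S(1)] S(2)] S(1) diji] by blast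
      then have "u' \<approx> (r @ [i]) @ [j]" using IH[OF S(1) d(1) ri] by simp
      then have "u \<approx> ((r @ [i]) @ [j]) @ [i]" using coxeter_cong_append refl1[OF S(1)] snoc by blast
      moreover have "reduced_word (w \<circ> ?j) ((r @ [j]) @ [i])"
        using r' snoc_desc[OF even[OF w S(2)] S(1) dji] snoc_desc[OF even[OF even[OF w S(2)] S(1)] S(2) djij] by blast
      then have "v' \<approx> (r @ [j]) @ [i]" using IH[OF S(2) d(2) rj] by simp
      then have "v \<approx> ((r @ [j]) @ [i]) @ [j]" using coxeter_cong_append refl1[OF S(2)] v by blast
      moreover have "r @ [i, j, i] \<approx> r @ [j, i, j]"
        using coxeter_cong_append[OF coxeter_cong.refl[OF reduced_word_lists[OF r]] coxeter_cong_braid[OF M S 3]] .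
      ultimately show ?thesis by (simp, meson coxeter_cong.sym coxeter_cong.trans)
    qed
  qed
qed

end

section \<open>The isomorphism with even signed permutations\<close>

context type_D
begin

lemma word_perm_replicate: "word_perm n (concat (replicate k [i, j])) = (node_perm n i \<circ> node_perm n j) ^^ k"
  by (induction k) (simp_all add: comp_assoc)

lemma word_perm_cong: "u \<approx> v \<Longrightarrow> word_perm n u = word_perm n v"
proof (induction rule: coxeter_cong.induct)
  case (rel i j u v)
  let ?i = "node_perm n i" and ?j = "node_perm n j"
  have ii: "?i \<circ> ?i = id" and jj: "?j \<circ> ?j = id" using rel node_perm_involutive by auto
  consider "D_matrix n i j = 1" | "D_matrix n i j = 2" | "D_matrix n i j = 3"
    using D_matrix_cases by blast
  then have "(?i \<circ> ?j) ^^ D_matrix n i j = id"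
  proof cases
    case 1
    then have "i = j" by (auto simp: D_matrix_def split: if_splits)
    then show ?thesis using 1 ii by simp
  next
    case 2
    have "(?i \<circ> ?j) \<circ> (?i \<circ> ?j) = (?i \<circ> ?j) \<circ> (?j \<circ> ?i)"
      using node_perm_commute[OF rel(1,2) 2] by simp
    also have "\<dots> = ?i \<circ> (?j \<circ> ?j) \<circ> ?i" by (simp add: comp_assoc)
    finally show ?thesis using 2 ii jj by (simp add: numeral_2_eq_2)
  next
    case 3
    have "(?i \<circ> ?j) \<circ> ((?i \<circ> ?j) \<circ> (?i \<circ> ?j)) = (?i \<circ> ?j \<circ> ?i) \<circ> (?j \<circ> ?i \<circ> ?j)"
      by (simp add: comp_assoc)
    also have "\<dots> = (?i \<circ> ?j \<circ> ?i) \<circ> (?i \<circ> ?j \<circ> ?i)"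
      using node_perm_braid[OF rel(1,2) 3] by simp
    also have "\<dots> = ?i \<circ> (?j \<circ> (?i \<circ> ?i) \<circ> ?j) \<circ> ?i" by (simp add: comp_assoc)
    finally show ?thesis using 3 ii jj by (simp add: numeral_3_eq_3)
  qed
  then show ?case by (simp add: word_perm_append word_perm_replicate)
qed auto

text \<open>Letters are appended one by one. An ascent keeps the word reduced; at a descent,
  Matsumoto's theorem rewrites the reduced word so that it ends in the same letter, and the two
  copies cancel. This is what makes the action faithful.\<close>

lemma cong_reduced_word: "u \<in> lists S \<Longrightarrow> \<exists>v. reduced_word (word_perm n u) v \<and> u \<approx> v"
proof (induction u rule: rev_induct)
  case Nil
  have "reduced_word (word_perm n []) []" by (simp add: reduced_word_def inversions_id[unfolded id_def] id_def)
  moreover have "[] \<approx> []" by (rule coxeter_cong.refl) simp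
  ultimately show ?case by blast
next
  case (snoc i u)
  let ?w = "word_perm n u" and ?i = "node_perm n i"
  have i: "i \<in> S" "u \<in> lists S" using snoc.prems by auto
  from snoc.IH[OF i(2)] obtain v where v: "reduced_word ?w v" "u \<approx> v" by blast
  have w: "?w \<in> even_signed_perms N" and wi: "?w \<circ> ?i \<in> even_signed_perms N"
    using word_perm_even i node_perm_even even_signed_perms_comp by blast+
  have refl_i: "[i] \<approx> [i]" using i by (simp add: coxeter_cong.refl)
  have wii: "?w \<circ> ?i \<circ> ?i = ?w" using node_perm_involutive[OF i(1)] by (simp add: comp_assoc)
  show ?case
  proof (cases "descent ?w i")
    case False
    have "descent (?w \<circ> ?i) i"
      using card_inversions_node_ascent[OF even_signed_permsD[OF w] i(1) False]
        card_inversions_node_ascent[OF even_signed_permsD[OF wi] i(1)] wii by force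
    then have "reduced_word (?w \<circ> ?i) (v @ [i])"
      using reduced_word_snoc[OF even_signed_permsD[OF wi] i(1)] v(1) wii by simp
    then show ?thesis
      using coxeter_cong_append[OF v(2) refl_i] unfolding word_perm_snoc by blast
  next
    case True
    obtain t where t: "reduced_word (?w \<circ> ?i) t" using reduced_word_exists[OF wi] by blast
    then have "reduced_word ?w (t @ [i])"
      using reduced_word_snoc[OF even_signed_permsD[OF w] i(1) True] by blast
    then have "u \<approx> t @ [i]" using reduced_word_unique[OF w v(1)] v(2) coxeter_cong.trans by blast
    then have "u @ [i] \<approx> t @ [i, i]" using coxeter_cong_append[OF _ refl_i] by fastforce
    moreover have "t @ [i, i] \<approx> t @ []"
      by (rule coxeter_cong_append[OF coxeter_cong.refl[OF reduced_word_lists[OF t]]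
        coxeter_cong_gen_gen[OF coxeter_matrix_D i(1)]])
    ultimately have "u @ [i] \<approx> t" using coxeter_cong.trans by fastforce
    with t show ?thesis unfolding word_perm_snoc by blast
  qed
qed

lemma cong_iff_word_perm:
  assumes "u \<in> lists S" "v \<in> lists S"
  shows "u \<approx> v \<longleftrightarrow> word_perm n u = word_perm n v"
proof
  assume eq: "word_perm n u = word_perm n v"
  obtain u' v' where *: "reduced_word (word_perm n u) u'" "u \<approx> u'" "reduced_word (word_perm n v) v'" "v \<approx> v'"
    using cong_reduced_word assms by blast
  then have "u' \<approx> v'" using reduced_word_unique[OF word_perm_even[OF assms(1)]] eq by simp
  then show "u \<approx> v" using * by (meson coxeter_cong.sym coxeter_cong.trans)
qed (rule word_perm_cong)

abbreviation W :: "nat list set monoid" where "W \<equiv> W_D n"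

text \<open>By faithfulness the fibres of \<open>word_perm n\<close> over the even signed
  permutations are exactly the congruence classes of words, so \<open>elt\<close> is the isomorphism
  onto the Coxeter group.\<close>

definition elt :: "(int \<Rightarrow> int) \<Rightarrow> nat list set" where
  "elt w = {u \<in> lists S. word_perm n u = w}"

lemma class_eq_elt: "u \<in> lists S \<Longrightarrow> coxeter_rel S (D_matrix n) `` {u} = elt (word_perm n u)"
proof -
  assume u: "u \<in> lists S"
  have "u \<approx> v \<longleftrightarrow> v \<in> lists S \<and> word_perm n v = word_perm n u" for v
    using cong_iff_word_perm[OF u, of v] coxeter_cong_lists[of S "D_matrix n" u v] by metis
  then show ?thesis unfolding coxeter_rel_def elt_def by blast
qed

lemma even_word: "w \<in> even_signed_perms N \<Longrightarrow> \<exists>u\<in>lists S. word_perm n u = w"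
  using reduced_word_exists unfolding reduced_word_def by blast

lemma carrier_W: "carrier W = elt ` even_signed_perms N"
proof -
  have "carrier W = (\<lambda>u. coxeter_rel S (D_matrix n) `` {u}) ` lists S"
    by (auto simp: coxeter_group_def quotient_def)
  also have "\<dots> = (\<lambda>u. elt (word_perm n u)) ` lists S"
    using class_eq_elt by (rule image_cong[OF HOL.refl])
  also have "\<dots> = elt ` word_perm n ` lists S"
    by (simp only: image_image)
  also have "word_perm n ` lists S = even_signed_perms N"
    using even_word word_perm_even by blast
  finally show ?thesis .
qed

lemma elt_mult:
  assumes "v \<in> even_signed_perms N" "w \<in> even_signed_perms N"
  shows "elt v \<otimes>\<^bsub>W\<^esub> elt w = elt (v \<circ> w)"
proof -
  obtain a b where ab: "a \<in> lists S" "word_perm n a = v" "b \<in> lists S" "word_perm n b = w"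
    using even_word assms by blast
  then have "a @ b \<in> lists S" by simp
  then show ?thesis
    using coxeter_mult_class[OF ab(1,3), of "D_matrix n"] ab class_eq_elt word_perm_append by metis
qed

lemma elt_one: "\<one>\<^bsub>W\<^esub> = elt id"
  using class_eq_elt[of "[]"] by (simp add: coxeter_group_def)

lemma elt_inj:
  assumes "v \<in> even_signed_perms N"
  shows "elt v = elt w \<longleftrightarrow> v = w"
proof -
  obtain u where "u \<in> lists S" "word_perm n u = v" using even_word[OF assms] by blast
  then show ?thesis by (auto simp: elt_def)
qed

lemma elt_carrier: "w \<in> even_signed_perms N \<Longrightarrow> elt w \<in> carrier W"
  by (simp add: carrier_W)

lemma group_W: "group W"
  by (rule coxeter_group_is_group[OF coxeter_matrix_D])

lemma elt_inv:
  assumes "w \<in> even_signed_perms N"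
  shows "inv\<^bsub>W\<^esub> (elt w) = elt (inv_into UNIV w)"
proof -
  interpret group W by (rule group_W)
  have i: "inv_into UNIV w \<in> even_signed_perms N" using even_signed_perms_inv[OF assms] .
  have "elt (inv_into UNIV w) \<otimes>\<^bsub>W\<^esub> elt w = \<one>\<^bsub>W\<^esub>"
    using elt_mult[OF i assms] signed_perms_inv_comp(1)[OF even_signed_permsD[OF assms]] elt_one by simp
  from inv_equality[OF this] show ?thesis using elt_carrier assms i by simp
qed

lemma elt_gen: "i \<in> S \<Longrightarrow> coxeter_gen S (D_matrix n) i = elt (node_perm n i)"
  using class_eq_elt[of "[i]"] by (simp add: coxeter_gen_def)

lemma elt_length:
  assumes w: "w \<in> even_signed_perms N"
  shows "2 * coxeter_length (elt w) = card (inversions N w)"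
proof -
  obtain u where u: "reduced_word w u" using reduced_word_exists[OF w] by blast
  have "coxeter_length (elt w) = length u"
    unfolding coxeter_length_def
  proof (rule Least_equality)
    show "\<exists>v\<in>elt w. length v = length u" using u by (auto simp: reduced_word_def elt_def)
    fix k assume "\<exists>v\<in>elt w. length v = k"
    then obtain v where "v \<in> lists S" "word_perm n v = w" "length v = k" by (auto simp: elt_def)
    then show "length u \<le> k" using card_inversions_word_perm[of v] u by (simp add: reduced_word_def)
  qed
  then show ?thesis using u by (simp add: reduced_word_def)
qed

lemma conjugate_elt:
  assumes "v \<in> even_signed_perms N" "w \<in> even_signed_perms N"
  shows "conjugate_in W (elt v) (elt w) \<longleftrightarrow> (\<exists>g\<in>even_signed_perms N. w \<circ> g = g \<circ> v)"
proof -
  have "elt w = elt g \<otimes>\<^bsub>W\<^esub> elt v \<otimes>\<^bsub>W\<^esub> inv\<^bsub>W\<^esub> (elt g) \<longleftrightarrow> w \<circ> g = g \<circ> v"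
    if g: "g \<in> even_signed_perms N" for g
  proof -
    note inv = signed_perms_inv_comp[OF even_signed_permsD[OF g]]
    have "elt w = elt g \<otimes>\<^bsub>W\<^esub> elt v \<otimes>\<^bsub>W\<^esub> inv\<^bsub>W\<^esub> (elt g) \<longleftrightarrow> w = g \<circ> v \<circ> inv_into UNIV g"
      using g assms by (simp add: elt_inv elt_mult even_signed_perms_comp even_signed_perms_inv elt_inj)
    also have "\<dots> \<longleftrightarrow> w \<circ> g = g \<circ> v"
      using inv(1,2) by (metis comp_assoc comp_id)
    finally show ?thesis .
  qed
  then show ?thesis using assms by (auto simp: conjugate_in_def carrier_W)
qed

lemma involution_elt:
  "w \<in> even_signed_perms N \<Longrightarrow> involution W (elt w) \<longleftrightarrow> w \<circ> w = id"
  by (simp add: involution_def elt_carrier elt_mult elt_one elt_inj even_signed_perms_comp)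

end

section \<open>Parabolic subgroups and longest elements\<close>

text \<open>The fundamental coweight dual to the simple root of the node \<open>t\<close> (twice that coweight for the
  two nodes \<open>n\<close> and \<open>n + 1\<close>), as the function \<open>x \<mapsto> \<langle>e\<^sub>x, \<omega>\<^sub>t\<rangle>\<close>.\<close>

definition coweight :: "nat \<Rightarrow> nat \<Rightarrow> int \<Rightarrow> int" where
  "coweight n t x = (if t = n + 1 then sgn x
     else if t = n then (if \<bar>x\<bar> = 1 then - sgn x else sgn x)
     else if \<bar>x\<bar> > int n + 1 - int t then sgn x else 0)"

lemma coweight_uminus: "coweight n t (- x) = - coweight n t x"
  by (simp add: coweight_def)

lemma coweight_orthogonal:
  assumes "t \<in> D_nodes n" "i \<in> D_nodes n" "i \<noteq> t"
  shows "coweight n t (lo n i) + coweight n t (hi n i) = 0"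
  using assms by (auto simp: coweight_def lo_def hi_def D_nodes_def sgn_if)

lemma coweight_simple_pos:
  assumes "i \<in> D_nodes n"
  shows "coweight n i (lo n i) + coweight n i (hi n i) > 0"
  using assms by (auto simp: coweight_def lo_def hi_def D_nodes_def sgn_if)

text \<open>The sum is the coefficient of the simple root of \<open>t\<close> in the positive root,
  doubled for \<open>t = n\<close> and \<open>t = n + 1\<close>.\<close>

lemma coweight_nonneg:
  assumes "root N x y" "x + y > 0" "t \<in> D_nodes n"
  shows "coweight n t x + coweight n t y \<ge> 0"
proof -
  have *: "coweight n t x + coweight n t y \<ge> 0" if "x \<noteq> 0" "\<bar>x\<bar> < y" for x y
  proof -
    have "y > 1" using that by simp
    with that assms(3) show ?thesis by (auto simp: coweight_def D_nodes_def sgn_if)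
  qed
  have "\<bar>x\<bar> < y \<or> \<bar>y\<bar> < x" using assms(1,2) by (auto simp: root_def)
  then show ?thesis using *[of x y] *[of y x] rootD[OF assms(1)] by (auto simp: add.commute)
qed

lemma coweight_node_perm:
  assumes "t \<in> D_nodes n" "i \<in> D_nodes n" "i \<noteq> t"
  shows "coweight n t (node_perm n i x) = coweight n t x"
  using coweight_orthogonal[OF assms]
  by (auto simp: node_perm_def reflect_def coweight_uminus)

context type_D
begin

definition parabolic_perms :: "nat set \<Rightarrow> (int \<Rightarrow> int) set" where
  "parabolic_perms I = {w \<in> even_signed_perms N. \<forall>t\<in>S - I. \<forall>x. coweight n t (w x) = coweight n t x}"

lemma parabolic_perms_even: "w \<in> parabolic_perms I \<Longrightarrow> w \<in> even_signed_perms N"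
  by (simp add: parabolic_perms_def)

lemma parabolic_perms_id: "id \<in> parabolic_perms I"
  by (simp add: parabolic_perms_def even_signed_perms_id)

lemma parabolic_perms_comp:
  "v \<in> parabolic_perms I \<Longrightarrow> w \<in> parabolic_perms I \<Longrightarrow> v \<circ> w \<in> parabolic_perms I"
  by (simp add: parabolic_perms_def even_signed_perms_comp)

lemma node_perm_parabolic: "i \<in> I \<Longrightarrow> i \<in> S \<Longrightarrow> node_perm n i \<in> parabolic_perms I"
  using coweight_node_perm[of _ n i] by (auto simp: parabolic_perms_def node_perm_even)

text \<open>For \<open>i\<close> outside \<open>I\<close>, the pairing of the simple root with its
  own coweight is positive and \<open>w\<close> preserves it, so the image cannot be a negative
  root. Removing descents therefore never leaves the stabilizer, and the nodes in \<open>I\<close>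
  generate it.\<close>

lemma parabolic_perms_descent:
  assumes w: "w \<in> parabolic_perms I" and i: "i \<in> S" "descent w i"
  shows "i \<in> I"
proof (rule ccontr)
  assume "i \<notin> I"
  then have *: "coweight n i (w x) = coweight n i x" for x using w i by (simp add: parabolic_perms_def)
  have w': "w \<in> signed_perms N" using w parabolic_perms_even even_signed_permsD by blast
  have "root N (- w (lo n i)) (- w (hi n i))"
    using signed_perms_root[OF w'] root_node[OF i(1)] by (simp add: root_def)
  from coweight_nonneg[OF this _ i(1)] i(2)
  have "coweight n i (w (lo n i)) + coweight n i (w (hi n i)) \<le> 0"
    by (simp add: coweight_uminus)
  then show False using coweight_simple_pos[OF i(1)] * by simp
qed

lemma parabolic_perms_induct [consumes 1, case_names id comp]:
  assumes "w \<in> parabolic_perms I" "P id"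
    and step: "\<And>v i. v \<in> parabolic_perms I \<Longrightarrow> i \<in> I \<Longrightarrow> i \<in> S \<Longrightarrow> P v \<Longrightarrow> P (v \<circ> node_perm n i)"
  shows "P w"
  using assms(1)
proof (induction "card (inversions N w)" arbitrary: w rule: less_induct)
  case less
  note w = parabolic_perms_even[OF less.prems]
  show ?case
  proof (cases "\<exists>i\<in>S. descent w i")
    case True
    then obtain i where i: "i \<in> S" "descent w i" by blast
    then have iI: "i \<in> I" using parabolic_perms_descent less.prems by blast
    let ?v = "w \<circ> node_perm n i"
    have v: "?v \<in> parabolic_perms I" using less.prems node_perm_parabolic iI i(1) parabolic_perms_comp by blast
    have "P ?v" using less.hyps[OF _ v] card_inversions_node_descent[OF even_signed_permsD[OF w] i] by simp
    then have "P (?v \<circ> node_perm n i)" using step v iI i(1) by blast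
    then show ?thesis using node_perm_involutive[OF i(1)] by (simp add: comp_assoc)
  next
    case False
    then have "w = id" using no_descent_id[OF w] by blast
    then show ?thesis using assms(2) by simp
  qed
qed

lemma parabolic_eq:
  assumes I: "I \<subseteq> S"
  shows "parabolic S (D_matrix n) I = elt ` parabolic_perms I"
proof (intro equalityI subsetI)
  fix x assume "x \<in> parabolic S (D_matrix n) I"
  then have "x \<in> generate W (coxeter_gen S (D_matrix n) ` I)" by (simp add: parabolic_def)
  then show "x \<in> elt ` parabolic_perms I"
  proof (induction rule: generate.induct)
    case one
    then show ?case using elt_one parabolic_perms_id by blast
  next
    case (incl h)
    then obtain i where i: "i \<in> I" "h = coxeter_gen S (D_matrix n) i" by blast
    then have "i \<in> S" using I by blast
    then show ?case using i elt_gen node_perm_parabolic by simp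
  next
    case (inv h)
    then obtain i where i: "i \<in> I" "h = coxeter_gen S (D_matrix n) i" by blast
    then have iS: "i \<in> S" using I by blast
    then have "inv_into UNIV (node_perm n i) = node_perm n i"
      using node_perm_involutive by (intro inv_unique_comp)
    then have "inv\<^bsub>W\<^esub> h = elt (node_perm n i)" using i iS elt_inv node_perm_even elt_gen by simp
    then show ?case using i iS node_perm_parabolic by simp
  next
    case (eng h1 h2)
    then obtain v w where vw: "v \<in> parabolic_perms I" "h1 = elt v" "w \<in> parabolic_perms I" "h2 = elt w"
      by blast
    then have "h1 \<otimes>\<^bsub>W\<^esub> h2 = elt (v \<circ> w)" using elt_mult parabolic_perms_even by simp
    then show ?case using parabolic_perms_comp vw by blast
  qed
next
  fix x assume "x \<in> elt ` parabolic_perms I"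
  then obtain w where w: "w \<in> parabolic_perms I" "x = elt w" by blast
  have "elt w \<in> generate W (coxeter_gen S (D_matrix n) ` I)" using w(1)
  proof (induction rule: parabolic_perms_induct)
    case id
    then show ?case using elt_one generate.one by metis
  next
    case (comp v i)
    have "elt (node_perm n i) \<in> generate W (coxeter_gen S (D_matrix n) ` I)"
      using elt_gen[OF comp(3)] comp(2) by (metis generate.incl imageI)
    then show ?case
      using generate.eng[OF comp(4)] elt_mult[OF parabolic_perms_even[OF comp(1)] node_perm_even[OF comp(3)]] by metis
  qed
  then show "x \<in> parabolic S (D_matrix n) I" using w(2) by (simp add: parabolic_def)
qed

text \<open>A positive root whose support lies in \<open>I\<close> is a sum of simple roots in \<open>I\<close>; peel them off one by one.\<close>

lemma negative_if_simple_negative: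
  assumes w: "w \<in> signed_perms N" and I: "\<And>i. i \<in> I \<Longrightarrow> descent w i"
  shows "root N x y \<Longrightarrow> x + y > 0 \<Longrightarrow> (\<And>t. t \<in> S - I \<Longrightarrow> coweight n t x + coweight n t y = 0) \<Longrightarrow> w x + w y < 0"
proof (induction "nat (x + y)" arbitrary: x y rule: less_induct)
  case less
  have main: "w x + w y < 0" if r: "root N x y" and pos: "x + y > 0" and xy: "\<bar>x\<bar> < y"
    and supp: "\<And>t. t \<in> S - I \<Longrightarrow> coweight n t x + coweight n t y = 0"
    and IH: "\<And>u v. u + v < x + y \<Longrightarrow> root N u v \<Longrightarrow> u + v > 0 \<Longrightarrow>
      (\<And>t. t \<in> S - I \<Longrightarrow> coweight n t u + coweight n t v = 0) \<Longrightarrow> w u + w v < 0" for x y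
  proof -
    have xN: "x \<noteq> 0" "y \<le> int N" using r by (auto simp: root_def coords_def)
    have split: "w x + w y < 0"
      if uv: "root N u v" "u + v > 0" "u + v < x + y" and i: "i \<in> S"
        \<comment> \<open>An identity between roots is stated through all odd functions, so that it
          can be applied both to the coweights and to \<open>w\<close>.\<close>
        and sum: "\<And>f :: int \<Rightarrow> int. (\<And>z. f (- z) = - f z) \<Longrightarrow> f x + f y = (f u + f v) + (f (lo n i) + f (hi n i))"
      for u v i
    proof -
      have "coweight n t u + coweight n t v = 0 \<and> coweight n t (lo n i) + coweight n t (hi n i) = 0"
        if "t \<in> S - I" for t
        using sum[of "coweight n t", OF coweight_uminus] supp[OF that] that
          coweight_nonneg[OF uv(1,2), of t n] coweight_nonneg[OF root_node[OF i], of t n]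
          simple_root_node[OF i] by (simp add: simple_root_def)
      moreover from this have "i \<in> I" using coweight_simple_pos[OF i] i by force
      ultimately show ?thesis
        using IH[OF uv(3,1,2)] I[of i] sum[of w, OF signed_perms_uminus[OF w]] by simp
    qed
    \<comment> \<open>The larger coordinate is lowered by 1 where possible. For
      \<open>x = y - 1\<close> that would make the coordinates equal, which is not a root, so
      \<open>x\<close> is lowered instead. The first and third cases are the simple roots.\<close>
    consider "x = - (y - 1)" | "\<bar>x\<bar> < y - 1" | "x = y - 1" "y = 2" | "x = y - 1" "y > 2"
      using xy xN by linarith
    then show ?thesis
    proof cases
      case 1
      define i where "i = nat (int n + 2 - y)"
      have i: "i \<in> S" "lo n i = x" "hi n i = y"
        using 1 xy xN by (auto simp: i_def D_nodes_def lo_def hi_def nat_eq_iff)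
      then have "i \<in> I" using supp[of i] coweight_simple_pos[of i n] by fastforce
      then show ?thesis using I[of i] i by simp
    next
      case 2
      define i where "i = nat (int n + 2 - y)"
      have i: "i \<in> S" "lo n i = - (y - 1)" "hi n i = y"
        using 2 xy xN by (auto simp: i_def D_nodes_def lo_def hi_def nat_eq_iff)
      show ?thesis
      proof (rule split[of x "y - 1" i])
        show "f x + f y = (f x + f (y - 1)) + (f (lo n i) + f (hi n i))"
          if "\<And>z. f (- z) = - f z" for f :: "int \<Rightarrow> int"
          using that[of "y - 1"] i by simp
      qed (use 2 xN r i in \<open>auto simp: root_def coords_def\<close>)
    next
      case 3
      have i: "n + 1 \<in> S" "lo n (n + 1) = x" "hi n (n + 1) = y"
        using 3 by (auto simp: D_nodes_def lo_def hi_def)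
      then have "n + 1 \<in> I" using supp[of "n + 1"] coweight_simple_pos[of "n + 1" n] by fastforce
      then show ?thesis using I[of "n + 1"] i by simp
    next
      case 4
      define i where "i = nat (int n + 2 - x)"
      have i: "i \<in> S" "lo n i = - (x - 1)" "hi n i = x"
        using 4 xN by (auto simp: i_def D_nodes_def lo_def hi_def nat_eq_iff)
      show ?thesis
      proof (rule split[of "x - 1" y i])
        show "f x + f y = (f (x - 1) + f y) + (f (lo n i) + f (hi n i))"
          if "\<And>z. f (- z) = - f z" for f :: "int \<Rightarrow> int"
          using that[of "x - 1"] i by simp
      qed (use 4 xN r i in \<open>auto simp: root_def coords_def\<close>)
    qed
  qed
  have IH: "w u + w v < 0" if "u + v < x + y" "root N u v" "u + v > 0"
      "\<And>t. t \<in> S - I \<Longrightarrow> coweight n t u + coweight n t v = 0" for u v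
    using less.hyps[of u v] that by simp
  have "\<bar>x\<bar> < y \<or> \<bar>y\<bar> < x" using less.prems(1,2) by (auto simp: root_def)
  then show ?case
  proof
    assume "\<bar>x\<bar> < y"
    then show ?thesis using main[of x y] less.prems IH by blast
  next
    assume "\<bar>y\<bar> < x"
    moreover have "root N y x" using less.prems(1) by (subst root_commute)
    ultimately show ?thesis using main[of y x] less.prems(2,3) IH by (simp add: add.commute)
  qed
qed

text \<open>The inverse of \<open>w\<close> sends a simple root to a root on which \<open>v\<close>
  and \<open>w\<close> have the same sign, namely positive. So \<open>v\<close> times that inverse
  has no descent.\<close>

lemma inversions_eq_imp_eq:
  assumes v: "v \<in> even_signed_perms N" and w: "w \<in> even_signed_perms N"
    and eq: "inversions N v = inversions N w"
  shows "v = w"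
proof -
  note v' = even_signed_permsD[OF v] and w' = even_signed_permsD[OF w]
  let ?wi = "inv_into UNIV w"
  have wi: "?wi \<in> even_signed_perms N" using even_signed_perms_inv[OF w] .
  note wi' = even_signed_permsD[OF wi]
  have "v \<circ> ?wi = id"
  proof (rule no_descent_id)
    show "v \<circ> ?wi \<in> even_signed_perms N" using even_signed_perms_comp[OF v wi] .
    fix i assume i: "i \<in> S"
    define a b where "a = ?wi (lo n i)" "b = ?wi (hi n i)"
    have ab: "w a + w b > 0" "root N a b" "root N (- a) (- b)"
      using simple_root_node[OF i] signed_perms_inv_comp(4)[OF w'] signed_perms_root[OF wi'] root_node[OF i]
      by (simp_all add: a_b_def simple_root_def root_def)
    have "v a + v b \<ge> 0"
    proof (cases "a + b > 0")
      case True
      then have "(a, b) \<notin> inversions N w" using ab by (simp add: inversions_def)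
      then have "(a, b) \<notin> inversions N v" using eq by simp
      then show ?thesis using True ab by (simp add: inversions_def)
    next
      case False
      then have "- a + - b > 0" using rootD[OF ab(2)] by simp
      then have "(- a, - b) \<in> inversions N w"
        using ab by (simp add: inversions_def signed_perms_uminus[OF w'])
      then have "(- a, - b) \<in> inversions N v" using eq by simp
      then show ?thesis by (simp add: inversions_def signed_perms_uminus[OF v'])
    qed
    then show "\<not> descent (v \<circ> ?wi) i" by (simp add: a_b_def)
  qed
  then have "v \<circ> ?wi \<circ> w = w" by simp
  then show ?thesis using signed_perms_inv_comp(1)[OF w'] by (simp add: comp_assoc)
qed

text \<open>Every inversion of an element of the parabolic subgroup is a root supported in
  \<open>I\<close>, hence an inversion of \<open>w\<close>. So \<open>w\<close> has maximal length,
  and equal length forces equal inversion sets, which gives the uniqueness demanded by the definite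
  description.\<close>

lemma longest_element_eq:
  assumes I: "I \<subseteq> S" and w: "w \<in> parabolic_perms I" and d: "\<And>i. i \<in> I \<Longrightarrow> descent w i"
  shows "longest_element S (D_matrix n) I = elt w"
proof -
  note w' = parabolic_perms_even[OF w]
  have sub: "inversions N v \<subseteq> inversions N w" if v: "v \<in> parabolic_perms I" for v
  proof (rule subrelI)
    fix x y assume xy: "(x, y) \<in> inversions N v"
    then have r: "root N x y" "x + y > 0" "v x + v y < 0" by (auto simp: inversions_def)
    have v': "v \<in> signed_perms N" using v parabolic_perms_even even_signed_permsD by blast
    have r': "root N (- v x) (- v y)" using r(1) signed_perms_root[OF v'] by (simp add: root_def)
    \<comment> \<open>The root is positive, its image under \<open>v\<close> is negative, and
      \<open>v\<close> preserves the pairing with the coweight, which is thus both nonnegative and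
      nonpositive.\<close>
    have "coweight n t x + coweight n t y = 0" if "t \<in> S - I" for t
      using coweight_nonneg[OF r(1,2), of t n] coweight_nonneg[OF r', of t n] r(3) v that
      by (simp add: coweight_uminus parabolic_perms_def)
    then have "w x + w y < 0"
      using negative_if_simple_negative[OF even_signed_permsD[OF w'] d r(1,2)] by blast
    with r show "(x, y) \<in> inversions N w" by (simp add: inversions_def)
  qed
  have le: "coxeter_length (elt v) \<le> coxeter_length (elt w)" if "v \<in> parabolic_perms I" for v
    using card_mono[OF finite_inversions sub[OF that]] elt_length[OF w'] elt_length[OF parabolic_perms_even[OF that]]
    by simp
  show ?thesis
    unfolding longest_element_def parabolic_eq[OF I]
  proof (rule the_equality)
    show "elt w \<in> elt ` parabolic_perms I \<and> (\<forall>v\<in>elt ` parabolic_perms I. coxeter_length v \<le> coxeter_length (elt w))"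
      using w le by blast
    fix x assume x: "x \<in> elt ` parabolic_perms I \<and> (\<forall>v\<in>elt ` parabolic_perms I. coxeter_length v \<le> coxeter_length x)"
    then obtain v where v: "v \<in> parabolic_perms I" "x = elt v" by blast
    note v' = parabolic_perms_even[OF v(1)]
    have "coxeter_length (elt w) \<le> coxeter_length (elt v)" using x w v by simp
    then have "card (inversions N w) \<le> card (inversions N v)" using elt_length[OF w'] elt_length[OF v'] by simp
    then have "inversions N v = inversions N w"
      using card_seteq[OF finite_inversions sub[OF v(1)]] by simp
    then show "x = elt w" using inversions_eq_imp_eq[OF v' w'] v by simp
  qed
qed

text \<open>For arbitrary \<open>I\<close> there is no explicit formula, but a standard involution
  may be presented by any \<open>I\<close>. An element with the most inversions works: an ascent in
  \<open>I\<close> would allow it to be lengthened.\<close>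

lemma longest_element_exists:
  assumes I: "I \<subseteq> S"
  shows "\<exists>w\<in>parabolic_perms I. longest_element S (D_matrix n) I = elt w"
proof -
  let ?f = "\<lambda>w. card (inversions N w)"
  have "?f w \<le> card (coords N \<times> coords N)" for w
    by (rule card_mono) (auto simp: finite_coords inversions_def root_def)
  then have "\<exists>w. w \<in> parabolic_perms I \<and> (\<forall>v. v \<in> parabolic_perms I \<longrightarrow> ?f v \<le> ?f w)"
    using ex_has_greatest_nat[of "\<lambda>w. w \<in> parabolic_perms I" id ?f "Suc (card (coords N \<times> coords N))"]
      parabolic_perms_id by (simp add: less_Suc_eq_le)
  then obtain w where w: "w \<in> parabolic_perms I" "\<And>v. v \<in> parabolic_perms I \<Longrightarrow> ?f v \<le> ?f w" by blast
  have "descent w i" if "i \<in> I" for i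
  proof (rule ccontr)
    assume "\<not> descent w i"
    moreover have iS: "i \<in> S" using that I by blast
    ultimately have "?f (w \<circ> node_perm n i) = ?f w + 2"
      using card_inversions_node_ascent w(1) parabolic_perms_even even_signed_permsD by blast
    moreover have "w \<circ> node_perm n i \<in> parabolic_perms I"
      using parabolic_perms_comp w(1) node_perm_parabolic that iS by blast
    ultimately show False using w(2) by fastforce
  qed
  then show ?thesis using longest_element_eq[OF I w(1)] w(1) by blast
qed

end

section \<open>Conjugacy of signed involutions\<close>

definition fixed_coords :: "nat \<Rightarrow> (int \<Rightarrow> int) \<Rightarrow> int set" where
  "fixed_coords N w = {x \<in> {1..int N}. w x = x}"

definition negated_coords :: "nat \<Rightarrow> (int \<Rightarrow> int) \<Rightarrow> int set" where
  "negated_coords N w = {x \<in> {1..int N}. w x = - x}"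

text \<open>For an involution, the smaller elements of the pairs of coordinates it exchanges.\<close>

definition leading_coords :: "nat \<Rightarrow> (int \<Rightarrow> int) \<Rightarrow> int set" where
  "leading_coords N w = {x \<in> {1..int N}. x < \<bar>w x\<bar>}"

lemma finite_coord_sets:
  "finite (fixed_coords N w)" "finite (negated_coords N w)" "finite (leading_coords N w)"
  unfolding fixed_coords_def negated_coords_def leading_coords_def
  by (rule finite_subset[of _ "{1..int N}"], blast, simp)+

lemma coords_pos_iff: "x \<in> {1..int N} \<longleftrightarrow> x \<in> coords N \<and> 0 < x"
  unfolding coords_def by (simp, arith)

locale signed_involution =
  fixes N :: nat and w :: "int \<Rightarrow> int"
  assumes signed: "w \<in> signed_perms N" and square: "w \<circ> w = id"
begin

lemma w_w: "w (w x) = x"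
  using square by (metis comp_apply id_apply)

lemma w_neg: "w (- x) = - w x"
  using signed_perms_uminus[OF signed] .

lemma w_abs: "w \<bar>w x\<bar> = sgn (w x) * x"
proof -
  have "w x \<noteq> 0 \<or> x = 0"
    using w_w[of x] w_neg[of 0] by force
  then show ?thesis using w_w[of x] w_neg[of "w x"] w_neg[of 0] by (auto simp: sgn_if abs_if)
qed

lemma abs_w_abs: "\<bar>w \<bar>w x\<bar>\<bar> = \<bar>x\<bar>"
proof (cases "w x = 0")
  case True
  then have "x = 0" using w_w[of x] w_neg[of 0] by simp
  with True show ?thesis by simp
qed (simp add: w_abs abs_mult)

lemma abs_w_in: "x \<in> {1..int N} \<Longrightarrow> \<bar>w x\<bar> \<in> {1..int N}"
  using signed_perms_in[OF signed, of x] unfolding coords_pos_iff by (auto simp: coords_def)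

lemma not_leading:
  assumes "x \<in> {1..int N}" "x \<notin> fixed_coords N w" "x \<notin> negated_coords N w" "x \<notin> leading_coords N w"
  shows "\<bar>w x\<bar> < x"
  using assms by (auto simp: fixed_coords_def negated_coords_def leading_coords_def)

lemma leading_partner:
  assumes "x \<in> {1..int N}" "\<bar>w x\<bar> < x"
  shows "\<bar>w x\<bar> \<in> leading_coords N w"
  using abs_w_in[OF assms(1)] abs_w_abs[of x] assms by (simp add: leading_coords_def)

text \<open>A coordinate that is neither fixed nor negated lies in a pair of \<open>x\<close> and
  \<open>\<bar>w x\<bar>\<close>, exactly one of which is leading.\<close>

lemma card_coords:
  "card (fixed_coords N w) + card (negated_coords N w) + 2 * card (leading_coords N w) = N"
proof -
  let ?F = "fixed_coords N w" and ?M = "negated_coords N w" and ?Q = "leading_coords N w"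
  let ?R = "(\<lambda>x. \<bar>w x\<bar>) ` ?Q"
  have fin: "finite ?F" "finite ?M" "finite ?Q" by (rule finite_coord_sets)+
  have R: "x \<in> {1..int N} \<and> \<bar>w x\<bar> < x" if xR: "x \<in> ?R" for x
  proof -
    obtain y where "x = \<bar>w y\<bar>" "y \<in> ?Q" using xR by blast
    then have y: "x = \<bar>w y\<bar>" "y \<in> {1..int N}" "y < \<bar>w y\<bar>" by (auto simp: leading_coords_def)
    then show ?thesis using abs_w_in[OF y(2)] abs_w_abs[of y] by simp
  qed
  have eq: "{1..int N} = (?F \<union> ?M) \<union> (?Q \<union> ?R)"
  proof (intro equalityI subsetI)
    fix x assume x: "x \<in> {1..int N}"
    show "x \<in> (?F \<union> ?M) \<union> (?Q \<union> ?R)"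
    proof (rule ccontr)
      assume "\<not> ?thesis"
      then have *: "x \<notin> ?R" "\<bar>w x\<bar> < x" using not_leading[OF x] by auto
      have "\<bar>w \<bar>w x\<bar>\<bar> = x" using abs_w_abs[of x] x by simp
      with leading_partner[OF x *(2)] have "x \<in> ?R" by (metis imageI)
      with * show False by simp
    qed
  next
    fix x assume "x \<in> (?F \<union> ?M) \<union> (?Q \<union> ?R)"
    then show "x \<in> {1..int N}" using R[of x]
      by (auto simp: fixed_coords_def negated_coords_def leading_coords_def)
  qed
  have "card ?R = card ?Q"
  proof (rule card_image)
    show "inj_on (\<lambda>x. \<bar>w x\<bar>) ?Q"
    proof (rule inj_onI)
      fix x y assume "x \<in> ?Q" "y \<in> ?Q" "\<bar>w x\<bar> = \<bar>w y\<bar>"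
      then show "x = y" using signed_perms_abs_eq[OF signed, of x y] by (auto simp: leading_coords_def)
    qed
  qed
  moreover have disj: "?F \<inter> ?M = {}" "?Q \<inter> ?R = {}" "(?F \<union> ?M) \<inter> (?Q \<union> ?R) = {}"
  proof -
    have F: "1 \<le> x \<and> w x = x" if "x \<in> ?F" for x using that by (simp add: fixed_coords_def)
    have M: "1 \<le> x \<and> w x = - x" if "x \<in> ?M" for x using that by (simp add: negated_coords_def)
    have Q: "1 \<le> x \<and> x < \<bar>w x\<bar>" if "x \<in> ?Q" for x using that by (simp add: leading_coords_def)
    have "\<not> (x \<in> ?F \<and> x \<in> ?M)" "\<not> (x \<in> ?Q \<and> x \<in> ?R)" "\<not> ((x \<in> ?F \<or> x \<in> ?M) \<and> (x \<in> ?Q \<or> x \<in> ?R))" for x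
      using F[of x] M[of x] Q[of x] R[of x] by linarith+
    then show "?F \<inter> ?M = {}" "?Q \<inter> ?R = {}" "(?F \<union> ?M) \<inter> (?Q \<union> ?R) = {}" by blast+
  qed
  moreover have "card {1..int N} = card (?F \<union> ?M) + card (?Q \<union> ?R)"
    unfolding eq by (rule card_Un_disjoint) (use fin disj in auto)
  moreover have "card (?F \<union> ?M) = card ?F + card ?M" "card (?Q \<union> ?R) = card ?Q + card ?R"
    using fin disj by (auto intro!: card_Un_disjoint)
  ultimately show ?thesis by simp
qed

end

text \<open>Fixed, negated and leading coordinates are matched by arbitrary bijections. The values
  on the other members of the pairs, and on negative coordinates, are then forced by the
  intertwining equation and by oddness.\<close>

lemma signed_involutions_conjugate:
  assumes v: "signed_involution N v" and w: "signed_involution N w"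
    and neg: "card (negated_coords N v) = card (negated_coords N w)"
    and lead: "card (leading_coords N v) = card (leading_coords N w)"
  shows "\<exists>h\<in>signed_perms N. w \<circ> h = h \<circ> v"
proof -
  interpret v: signed_involution N v by (rule v)
  interpret w: signed_involution N w by (rule w)
  have fix_card: "card (fixed_coords N v) = card (fixed_coords N w)"
    using v.card_coords w.card_coords neg lead by simp
  have fin: "finite (fixed_coords N u)" "finite (negated_coords N u)" "finite (leading_coords N u)" for u
    by (rule finite_coord_sets)+
  obtain f where f: "bij_betw f (fixed_coords N v) (fixed_coords N w)"
    using finite_same_card_bij[OF fin(1,1) fix_card] by blast
  obtain m where m: "bij_betw m (negated_coords N v) (negated_coords N w)"
    using finite_same_card_bij[OF fin(2,2) neg] by blast
  obtain q where q: "bij_betw q (leading_coords N v) (leading_coords N w)"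
    using finite_same_card_bij[OF fin(3,3) lead] by blast
  define g where "g x = (if v x = x then f x else if v x = - x then m x else q x)" for x
  \<comment> \<open>For the larger member \<open>x\<close> of a pair,
    \<open>x = sgn (v x) * v \<bar>v x\<bar>\<close>, and \<open>h\<close> is to turn this
    \<open>v\<close> into \<open>w\<close>.\<close>
  define h0 where "h0 x = (if \<bar>v x\<bar> < x then sgn (v x) * w (g \<bar>v x\<bar>) else g x)" for x
  define h where "h x = (if x \<in> coords N then sgn x * h0 \<bar>x\<bar> else x)" for x
  have gF: "g x \<in> fixed_coords N w" if "x \<in> fixed_coords N v" for x
    using bij_betwE[OF f] that by (simp add: g_def fixed_coords_def)
  have gM: "g x \<in> negated_coords N w" if "x \<in> negated_coords N v" for x
    proof -
    have "v x \<noteq> x" "v x = - x" using that by (auto simp: negated_coords_def)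
    then show ?thesis using bij_betwE[OF m] that by (simp add: g_def)
  qed
  have gQ: "g x \<in> leading_coords N w" if "x \<in> leading_coords N v" for x
    proof -
    have "v x \<noteq> x" "v x \<noteq> - x" using that by (auto simp: leading_coords_def)
    then show ?thesis using bij_betwE[OF q] that by (simp add: g_def)
  qed
  have h_neg: "h (- x) = - h x" for x
    by (auto simp: h_def)
  have h_pos: "h x = h0 x" if "x \<in> {1..int N}" for x
    using that unfolding coords_pos_iff by (simp add: h_def)
  have h_g: "h x = g x" if "x \<in> {1..int N}" "\<not> \<bar>v x\<bar> < x" for x
    using h_pos[OF that(1)] that(2) by (simp add: h0_def)
  have h_sgn: "h (sgn (v y) * x) = sgn (v y) * h x" if "y \<in> {1..int N}" for x y
  proof -
    have "\<bar>v y\<bar> \<in> {1..int N}" using v.abs_w_in[OF that] .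
    then have "v y \<noteq> 0" by auto
    then show ?thesis using h_neg[of x] by (auto simp: sgn_if)
  qed
  have sgn_sq: "sgn (v y) * sgn (v y) = 1" if "y \<in> {1..int N}" for y
  proof -
    have "\<bar>v y\<bar> \<in> {1..int N}" using v.abs_w_in[OF that] .
    then show ?thesis by (auto simp: sgn_if)
  qed
  have w_sgn: "w (sgn (v y) * x) = sgn (v y) * w x" if "y \<in> {1..int N}" for x y
    using sgn_sq[OF that] w.w_neg[of x] by (auto simp: sgn_if split: if_splits)
  have sgn_abs: "v y = sgn (v y) * \<bar>v y\<bar>" for y by (simp add: sgn_if abs_if)
  have cases: "x \<in> fixed_coords N u \<or> x \<in> negated_coords N u \<or> x \<in> leading_coords N u \<or> \<bar>u x\<bar> < x"
    if "x \<in> {1..int N}" for x u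
    using that by (auto simp: fixed_coords_def negated_coords_def leading_coords_def)
  have inter_pos: "w (h x) = h (v x)" if x: "x \<in> {1..int N}" for x
    using cases[OF x, of v]
  proof (elim disjE)
    assume xF: "x \<in> fixed_coords N v"
    then show ?thesis using h_g[OF x] gF[OF xF] by (simp add: fixed_coords_def)
  next
    assume xM: "x \<in> negated_coords N v"
    then show ?thesis using h_g[OF x] gM[OF xM] h_neg by (simp add: negated_coords_def)
  next
    assume xQ: "x \<in> leading_coords N v"
    let ?y = "\<bar>v x\<bar>"
    have y: "?y \<in> {1..int N}" using v.abs_w_in[OF x] .
    have "x < ?y" using xQ by (simp add: leading_coords_def)
    moreover have vy: "v ?y = sgn (v x) * x" "\<bar>v ?y\<bar> = x" using v.w_abs v.abs_w_abs x by simp_all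
    moreover have "sgn (v ?y) = sgn (v x)" using vy x by (simp add: sgn_mult)
    ultimately have "h ?y = sgn (v x) * w (g x)" using h_pos[OF y] by (simp add: h0_def)
    moreover have "h (v x) = sgn (v x) * h ?y" using h_sgn[OF x, of ?y] sgn_abs[of x] by simp
    ultimately have "h (v x) = (sgn (v x) * sgn (v x)) * w (g x)" by simp
    then show ?thesis using sgn_sq[OF x] h_g[OF x] \<open>x < ?y\<close> by simp
  next
    assume lt: "\<bar>v x\<bar> < x"
    let ?y = "\<bar>v x\<bar>"
    have y: "?y \<in> {1..int N}" using v.abs_w_in[OF x] .
    have "\<not> \<bar>v ?y\<bar> < ?y" using v.abs_w_abs[of x] lt x by simp
    then have "h (v x) = sgn (v x) * g ?y" using h_sgn[OF x, of ?y] sgn_abs[of x] h_g[OF y] by simp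
    moreover have "h x = sgn (v x) * w (g ?y)" using h_pos[OF x] lt by (simp add: h0_def)
    ultimately show ?thesis using w_sgn[OF x] w.w_w by simp
  qed
  have inter: "w (h x) = h (v x)" for x
  proof (cases "x \<in> coords N")
    case True
    then have "x \<in> {1..int N} \<or> - x \<in> {1..int N}" by (auto simp: coords_def)
    then show ?thesis using inter_pos[of x] inter_pos[of "- x"] h_neg v.w_neg w.w_neg by auto
  next
    case False
    then show ?thesis using signed_perms_fix[OF v.signed] signed_perms_fix[OF w.signed] by (simp add: h_def)
  qed
  \<comment> \<open>Surjectivity suffices, because \<open>coords N\<close> is finite.\<close>
  have surj_pos: "\<exists>x\<in>coords N. h x = y" if y: "y \<in> {1..int N}" for y
    using cases[OF y, of w]
  proof (elim disjE)
    assume "y \<in> fixed_coords N w"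
    then obtain x where x: "x \<in> fixed_coords N v" "f x = y" using f by (metis bij_betw_imp_surj_on imageE)
    then have "x \<in> {1..int N}" "h x = y" using h_g[of x] by (auto simp: fixed_coords_def g_def)
    then show ?thesis unfolding coords_pos_iff by blast
  next
    assume "y \<in> negated_coords N w"
    then obtain x where x: "x \<in> negated_coords N v" "m x = y" using m by (metis bij_betw_imp_surj_on imageE)
    then have "x \<in> {1..int N}" "h x = y" using h_g[of x] by (auto simp: negated_coords_def g_def)
    then show ?thesis unfolding coords_pos_iff by blast
  next
    assume "y \<in> leading_coords N w"
    then obtain x where x: "x \<in> leading_coords N v" "q x = y" using q by (metis bij_betw_imp_surj_on imageE)
    then have "x \<in> {1..int N}" "h x = y" using h_g[of x] by (auto simp: leading_coords_def g_def)
    then show ?thesis unfolding coords_pos_iff by blast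
  next
    assume lt: "\<bar>w y\<bar> < y"
    then have "\<bar>w y\<bar> \<in> leading_coords N w" using w.leading_partner[OF y] by blast
    then obtain z where z: "z \<in> leading_coords N v" "q z = \<bar>w y\<bar>" using q by (metis bij_betw_imp_surj_on imageE)
    then have zN: "z \<in> {1..int N}" and hz: "h z = \<bar>w y\<bar>" using h_g[of z] by (auto simp: leading_coords_def g_def)
    have "h (v z) = sgn (w y) * y" using inter[of z] hz w.w_abs[of y] by simp
    moreover have "sgn (w y) = 1 \<or> sgn (w y) = - 1" using w.abs_w_in[OF y] by (auto simp: sgn_if)
    ultimately have "h (v z) = y \<or> h (- v z) = y" using h_neg by auto
    moreover have "v z \<in> coords N" using zN signed_perms_in[OF v.signed] unfolding coords_pos_iff by blast
    ultimately show ?thesis by (metis coords_uminus)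
  qed
  have "y \<in> h ` coords N" if "y \<in> coords N" for y
  proof -
    have "y \<in> {1..int N} \<or> - y \<in> {1..int N}" using that by (auto simp: coords_def)
    then obtain x where "x \<in> coords N" "h x = y \<or> h x = - y" using surj_pos by blast
    then show ?thesis by (metis coords_uminus h_neg imageI minus_minus)
  qed
  then have sub: "coords N \<subseteq> h ` coords N" by blast
  then have im: "h ` coords N = coords N"
    using card_image_le[OF finite_coords, of h N] card_seteq[of "h ` coords N" "coords N"] finite_coords
    by blast
  then have "bij_betw h (coords N) (coords N)"
    using finite_surj_inj[OF finite_coords, of N h] by (simp add: bij_betw_def)
  then have "h permutes coords N" by (rule bij_imp_permutes) (simp add: h_def)
  then have "h \<in> signed_perms N" using h_neg by (simp add: signed_perms_def)
  moreover have "w \<circ> h = h \<circ> v" using inter by (simp add: fun_eq_iff)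
  ultimately show ?thesis by blast
qed

lemma even_card_fixpoint_free:
  assumes "finite A" "\<And>x. x \<in> A \<Longrightarrow> f x \<in> A" "\<And>x. x \<in> A \<Longrightarrow> f (f x) = x" "\<And>x. x \<in> A \<Longrightarrow> f x \<noteq> x"
  shows "even (card A)"
  using assms
proof (induction "card A" arbitrary: A rule: less_induct)
  case less
  show ?case
  proof (cases "A = {}")
    case False
    then obtain x where x: "x \<in> A" by blast
    let ?B = "A - {x, f x}"
    have sub: "{x, f x} \<subseteq> A" "f x \<noteq> x" using less.prems x by auto
    then have "card {x, f x} = 2" by auto
    moreover have "card {x, f x} \<le> card A" using sub less.prems(1) by (intro card_mono) auto
    ultimately have c: "card A = card ?B + 2"
      using card_Diff_subset[of "{x, f x}" A] sub(1) by simp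
    have "even (card ?B)"
    proof (rule less.hyps)
      show "f y \<in> ?B" if "y \<in> ?B" for y
        using that less.prems(2,3) x by (metis Diff_iff insert_iff singletonD)
    qed (use less.prems c in auto)
    with c show ?thesis by simp
  qed simp
qed

text \<open>The coordinates with negative image that are not negated are paired off by
  \<open>\<lambda>x. - w x\<close>, so the negated ones have the parity of all sign changes.\<close>

lemma even_card_negated:
  assumes "signed_involution N w" and e: "w \<in> even_signed_perms N"
  shows "even (card (negated_coords N w))"
proof -
  interpret signed_involution N w by fact
  let ?A = "{x \<in> {1..int N}. w x < 0}" and ?M = "negated_coords N w"
  have "even (card ?A)"
    using e signature_card[OF signed] by (auto simp: even_signed_perms_def minus_one_power_iff split: if_splits)
  moreover have "even (card (?A - ?M))"
  proof (rule even_card_fixpoint_free[where f = "\<lambda>x. - w x"])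
    fix x assume x: "x \<in> ?A - ?M"
    then have "- w x \<in> {1..int N}" using abs_w_in[of x] by auto
    moreover have "w (- w x) = - x" using w_w w_neg by simp
    ultimately show "- w x \<in> ?A - ?M" using x by (auto simp: negated_coords_def)
    show "- w (- w x) = x" using w_w w_neg by simp
    show "- w x \<noteq> x" using x by (auto simp: negated_coords_def)
  qed (rule finite_subset[of _ "{1..int N}"], auto)
  moreover have "card ?A = card ?M + card (?A - ?M)"
  proof -
    have "?M \<subseteq> ?A" by (auto simp: negated_coords_def)
    moreover have "finite ?A" by (rule finite_subset[of _ "{1..int N}"]) auto
    ultimately show ?thesis
      using card_Diff_subset[OF finite_coord_sets(2), of N w ?A] card_mono[of ?A ?M] by simp
  qed
  ultimately show ?thesis by simp
qed

section \<open>The elements \<open>c\<^sub>k\<^sub>,\<^sub>l\<close>, \<open>c\<^sub>-\<close> and \<open>c\<^sub>+\<close>\<close>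

text \<open>Exchanges \<open>2 j - 1\<close> and \<open>2 j\<close>, and their negatives; not meant for \<open>0\<close>.\<close>

definition pair_swap :: "int \<Rightarrow> int" where
  "pair_swap x = (if odd x \<longleftrightarrow> x > 0 then x + 1 else x - 1)"

lemma pair_swap_pair_swap: "x \<noteq> 0 \<Longrightarrow> pair_swap (pair_swap x) = x"
  by (auto simp: pair_swap_def)

lemma pair_swap_uminus: "x \<noteq> 0 \<Longrightarrow> pair_swap (- x) = - pair_swap x"
  by (auto simp: pair_swap_def)

lemma pair_swap_pos_iff:
  assumes "x \<noteq> 0"
  shows "pair_swap x > 0 \<longleftrightarrow> x > 0"
proof -
  have "even x \<Longrightarrow> x > 0 \<Longrightarrow> x \<ge> 2" "odd x \<Longrightarrow> x < 0 \<Longrightarrow> x \<le> - 1" "even x \<Longrightarrow> x < 0 \<Longrightarrow> x \<le> - 2"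
    by presburger+
  then show ?thesis using assms by (auto simp: pair_swap_def)
qed

lemma pair_swap_nz: "x \<noteq> 0 \<Longrightarrow> pair_swap x \<noteq> 0"
  by (auto simp: pair_swap_def)

lemma sgn_pair_swap: "x \<noteq> 0 \<Longrightarrow> sgn (pair_swap x) = sgn x"
  using pair_swap_pos_iff[of x] pair_swap_nz[of x] by (auto simp: sgn_if)

lemma abs_pair_swap: "x \<noteq> 0 \<Longrightarrow> \<bar>pair_swap x\<bar> = (if odd x then \<bar>x\<bar> + 1 else \<bar>x\<bar> - 1)"
  by (cases "x > 0") (auto simp: pair_swap_def elim!: evenE)

lemma abs_pair_swap_le: "x \<noteq> 0 \<Longrightarrow> even b \<Longrightarrow> \<bar>pair_swap x\<bar> \<le> b \<longleftrightarrow> \<bar>x\<bar> \<le> b"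
  unfolding abs_pair_swap by (cases "x > 0") (simp_all, presburger+)

lemma abs_pair_swap_ge: "x \<noteq> 0 \<Longrightarrow> odd a \<Longrightarrow> a \<le> \<bar>pair_swap x\<bar> \<longleftrightarrow> a \<le> \<bar>x\<bar>"
  using abs_pair_swap_le[of x "a - 1"] by auto

text \<open>The sign change of the first coordinate, which normalizes but does not belong to the group.\<close>

definition flip_one :: "int \<Rightarrow> int" where
  "flip_one x = (if \<bar>x\<bar> = 1 then - x else x)"

lemma flip_one_flip_one [simp]: "flip_one (flip_one x) = x"
  by (simp add: flip_one_def)

lemma flip_one_signed: "N \<ge> 1 \<Longrightarrow> flip_one \<in> signed_perms N"
  by (rule signed_perms_involutionI) (auto simp: flip_one_def coords_def)

lemma signature_flip_one:
  assumes "N \<ge> 1"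
  shows "signature N flip_one = - 1"
proof -
  have "{x \<in> {1..int N}. flip_one x < 0} = {1}" using assms by (auto simp: flip_one_def split: if_splits)
  then show ?thesis using signature_card[OF flip_one_signed[OF assms]] by simp
qed

locale odd_type_D = type_D +
  assumes odd_n: "odd n"
begin

text \<open>The nodes \<open>1, 3, \<dots>, 2 k - 1\<close> exchange adjacent coordinates at the top, and \<open>J_set n l\<close> negates
  the coordinates up to \<open>l + 1\<close>, with the exception of the first one if \<open>l\<close> is even. The case
  \<open>l = 0\<close>, \<open>2 k = n + 1\<close> is that of \<open>c_minus\<close>.\<close>

definition cfun :: "nat \<Rightarrow> nat \<Rightarrow> int \<Rightarrow> int" where
  "cfun k l x = (if int n + 2 - 2 * int k \<le> \<bar>x\<bar> \<and> \<bar>x\<bar> \<le> int n + 1 then pair_swap x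
     else if (if odd l then 1 else 2) \<le> \<bar>x\<bar> \<and> \<bar>x\<bar> \<le> int l + 1 then - x else x)"

definition admissible :: "nat \<Rightarrow> nat \<Rightarrow> bool" where
  "admissible k l \<longleftrightarrow> 2 * k + l \<le> n \<or> l = 0 \<and> 2 * k = n + 1"

text \<open>Admissibility keeps the swapped coordinates at the top apart from the negated ones at
  the bottom; the additional inequalities in the cases record this.\<close>

lemma cfun_cases [consumes 1, case_names swap neg same]:
  assumes "admissible k l"
  obtains (swap) "int n + 2 - 2 * int k \<le> \<bar>x\<bar>" "\<bar>x\<bar> \<le> int n + 1" "cfun k l x = pair_swap x" "x \<noteq> 0"
      "int l + 1 < \<bar>x\<bar> \<or> l = 0"
    | (neg) "(if odd l then 1 else 2) \<le> \<bar>x\<bar>" "\<bar>x\<bar> \<le> int l + 1" "cfun k l x = - x" "x \<noteq> 0"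
      "\<bar>x\<bar> < int n + 2 - 2 * int k" "l > 0" "2 * k + l \<le> n"
    | (same) "cfun k l x = x" "int n + 1 < \<bar>x\<bar> \<or> \<bar>x\<bar> < int n + 2 - 2 * int k"
      "\<bar>x\<bar> < (if odd l then 1 else 2) \<or> int l + 1 < \<bar>x\<bar>"
proof -
  consider (a) "int n + 2 - 2 * int k \<le> \<bar>x\<bar> \<and> \<bar>x\<bar> \<le> int n + 1"
    | (b) "\<not> (int n + 2 - 2 * int k \<le> \<bar>x\<bar> \<and> \<bar>x\<bar> \<le> int n + 1)"
      "(if odd l then 1 else 2) \<le> \<bar>x\<bar> \<and> \<bar>x\<bar> \<le> int l + 1"
    | (c) "\<not> (int n + 2 - 2 * int k \<le> \<bar>x\<bar> \<and> \<bar>x\<bar> \<le> int n + 1)"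
      "\<not> ((if odd l then 1 else 2) \<le> \<bar>x\<bar> \<and> \<bar>x\<bar> \<le> int l + 1)" by blast
  then show thesis
  proof cases
    case a
    then have "x \<noteq> 0" "int l + 1 < \<bar>x\<bar> \<or> l = 0" using assms by (auto simp: admissible_def)
    then show thesis using swap a by (simp add: cfun_def)
  next
    case b
    then have "l > 0" by (auto split: if_splits intro!: Nat.gr0I)
    then have kl: "2 * k + l \<le> n" using assms by (auto simp: admissible_def)
    have "\<bar>x\<bar> < int n + 2 - 2 * int k" using b(2) kl by simp
    moreover have "x \<noteq> 0" using b(2) by (auto split: if_splits)
    ultimately show thesis using neg b \<open>l > 0\<close> kl by (simp add: cfun_def)
  next
    case c
    then show thesis using same by (auto simp: cfun_def)
  qed
qed

text \<open>As \<open>n\<close> is odd, the swapped block starts at an odd and ends at an even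
  coordinate, so it is a union of whole pairs of \<open>pair_swap\<close>.\<close>

lemma odd_even_bounds: "odd (int n + 2 - 2 * int k)" "even (int n + 1)"
  using odd_n by auto

lemma cfun_pair_swap_range:
  assumes "x \<noteq> 0"
  shows "int n + 2 - 2 * int k \<le> \<bar>pair_swap x\<bar> \<longleftrightarrow> int n + 2 - 2 * int k \<le> \<bar>x\<bar>"
    "\<bar>pair_swap x\<bar> \<le> int n + 1 \<longleftrightarrow> \<bar>x\<bar> \<le> int n + 1"
  using abs_pair_swap_ge[OF assms odd_even_bounds(1)] abs_pair_swap_le[OF assms odd_even_bounds(2)] by simp_all

lemma cfun_cfun:
  assumes "admissible k l"
  shows "cfun k l (cfun k l x) = x"
using assms
proof (cases rule: cfun_cases[where x = x])
  case swap
  then have "cfun k l (pair_swap x) = pair_swap (pair_swap x)"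
    using cfun_pair_swap_range(1)[OF swap(4), of k] cfun_pair_swap_range(2)[OF swap(4)] unfolding cfun_def by simp
  then show ?thesis using swap pair_swap_pair_swap by simp
next
  case neg
  then show ?thesis by (simp add: cfun_def)
qed simp

lemma cfun_signed_involution:
  assumes "admissible k l"
  shows "signed_involution N (cfun k l)"
proof
  show "cfun k l \<in> signed_perms N"
  proof (rule signed_perms_involutionI)
    show "cfun k l (cfun k l x) = x" for x by (rule cfun_cfun[OF assms])
    show "cfun k l (- x) = - cfun k l x" for x
      by (rule cfun_cases[OF assms, of x]) (auto simp: cfun_def pair_swap_uminus)
    show "cfun k l x \<in> coords N" if "x \<in> coords N" for x
    using assms
    proof (cases rule: cfun_cases[where x = x])
      case swap
      then show ?thesis using cfun_pair_swap_range(2)[OF swap(4)] pair_swap_nz by (simp add: coords_def)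
    qed (use that in \<open>auto simp: coords_def\<close>)
    show "cfun k l x = x" if "x \<notin> coords N" for x
    using assms
    proof (cases rule: cfun_cases[where x = x])
      case neg
      then show ?thesis using that by (simp add: coords_def)
    qed (use that in \<open>auto simp: coords_def\<close>)
  qed
  show "cfun k l \<circ> cfun k l = id" using cfun_cfun[OF assms] by (simp add: fun_eq_iff)
qed

lemma cfun_negative_iff:
  assumes "admissible k l" "x \<in> {1..int N}"
  shows "cfun k l x < 0 \<longleftrightarrow> x \<in> {(if odd l then 1 else 2)..int l + 1}"
    "cfun k l x = - x \<longleftrightarrow> x \<in> {(if odd l then 1 else 2)..int l + 1}"
proof -
  let ?R = "{(if odd l then 1 else 2)..int l + 1}"
  have in_R: "cfun k l x = - x" if "x \<in> ?R"
    using assms(1)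
  proof (cases rule: cfun_cases[where x = x])
    case swap
    then show ?thesis using that assms(2) by (auto split: if_splits)
  next
    case neg
    then show ?thesis using that assms(2) by auto
  next
    case same
    then show ?thesis using that assms(2) by (auto split: if_splits)
  qed
  have not_in_R: "cfun k l x > 0" if "x \<notin> ?R"
  using assms(1)
  proof (cases rule: cfun_cases[where x = x])
    case swap
    then show ?thesis using pair_swap_pos_iff[OF swap(4)] assms(2) by simp
  next
    case neg
    then show ?thesis using that assms(2) by (auto split: if_splits)
  qed (use assms(2) in simp)
  show "cfun k l x < 0 \<longleftrightarrow> x \<in> ?R" "cfun k l x = - x \<longleftrightarrow> x \<in> ?R"
    using in_R not_in_R assms(2) by (cases "x \<in> ?R"; force)+
qed

lemma card_cfun_range: "card {(if odd l then 1 else 2)..int l + 1} = (if odd l then l + 1 else l)"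
  by (simp add: nat_add_distrib)

lemma admissible_le: "admissible k l \<Longrightarrow> l \<le> n"
  by (auto simp: admissible_def)

lemma card_negated_cfun:
  assumes "admissible k l"
  shows "card (negated_coords N (cfun k l)) = (if odd l then l + 1 else l)"
proof -
  have "negated_coords N (cfun k l) = {(if odd l then 1 else 2)..int l + 1}"
    using cfun_negative_iff(2)[OF assms] admissible_le[OF assms]
    by (auto simp: negated_coords_def split: if_splits)
  then show ?thesis using card_cfun_range[of l] by simp
qed

lemma cfun_even:
  assumes "admissible k l"
  shows "cfun k l \<in> even_signed_perms N"
proof -
  interpret signed_involution N "cfun k l" by (rule cfun_signed_involution[OF assms])
  have "{x \<in> {1..int N}. cfun k l x < 0} = {(if odd l then 1 else 2)..int l + 1}"
    using cfun_negative_iff(1)[OF assms] admissible_le[OF assms]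
    by (auto split: if_splits)
  then have "card {x \<in> {1..int N}. cfun k l x < 0} = (if odd l then l + 1 else l)"
    using card_cfun_range[of l] by simp
  then show ?thesis using signature_card[OF signed] signed by (simp add: even_signed_perms_def)
qed

lemma card_leading_cfun:
  assumes "admissible k l"
  shows "card (leading_coords N (cfun k l)) = k"
proof -
  have "leading_coords N (cfun k l) = (\<lambda>j. int n + 2 - 2 * int j) ` {1..k}"
  proof (intro equalityI subsetI)
    fix x assume "x \<in> leading_coords N (cfun k l)"
    then have x: "1 \<le> x" "x < \<bar>cfun k l x\<bar>" by (auto simp: leading_coords_def)
    from assms show "x \<in> (\<lambda>j. int n + 2 - 2 * int j) ` {1..k}"
    proof (cases rule: cfun_cases[where x = x])
      case swap
      then have odd: "odd x" using x abs_pair_swap[of x] by (auto split: if_splits)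
      define j where "j = nat ((int n + 2 - x) div 2)"
      have "even (int n + 2 - x)" using odd odd_n by simp
      moreover have "x \<noteq> int n + 1" using odd odd_n by auto
      ultimately have "int n + 2 - 2 * int j = x" "j \<in> {1..k}"
        using swap x by (auto simp: j_def)
      then show ?thesis by force
    qed (use x in auto)
  next
    fix x assume "x \<in> (\<lambda>j. int n + 2 - 2 * int j) ` {1..k}"
    then obtain j where j: "1 \<le> j" "j \<le> k" "x = int n + 2 - 2 * int j" by auto
    have kn: "2 * k \<le> n + 1" using assms by (auto simp: admissible_def)
    have "1 \<le> x" "x \<le> int n" "odd x" using j kn odd_n by auto
    moreover have "cfun k l x = pair_swap x" using j \<open>1 \<le> x\<close> by (simp add: cfun_def)
    ultimately show "x \<in> leading_coords N (cfun k l)"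
      by (simp add: leading_coords_def abs_pair_swap)
  qed
  moreover have "inj_on (\<lambda>j. int n + 2 - 2 * int j) {1..k}" by (auto simp: inj_on_def)
  ultimately show ?thesis by (simp add: card_image)
qed

lemma I_set_subset: "admissible k l \<Longrightarrow> I_set n k l \<subseteq> S"
  by (auto simp: I_set_def J_set_def D_nodes_def admissible_def)

lemma I_set_cases:
  assumes "admissible k l" "i \<in> I_set n k l"
  obtains (pair) c where "lo n i = - c" "hi n i = c + 1" "odd c" "int n + 2 - 2 * int k \<le> c" "c \<le> int n"
    | (sign) "l > 0" "lo n i = 1" "hi n i = 2"
    | (inner) c where "l > 0" "lo n i = - c" "hi n i = c + 1" "1 \<le> c" "c \<le> int l"
proof -
  have "i \<in> {2 * i - 1 |i. 1 \<le> i \<and> i \<le> k} \<or> l > 0 \<and> i \<in> {n + 1 - l..n + 1}"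
    using assms(2) by (auto simp: I_set_def J_set_def split: if_splits)
  then show thesis
  proof (elim disjE conjE)
    assume "i \<in> {2 * i - 1 |i. 1 \<le> i \<and> i \<le> k}"
    then obtain j where j: "i = 2 * j - 1" "1 \<le> j" "j \<le> k" by blast
    have kn: "2 * k \<le> n + 1" using assms(1) by (auto simp: admissible_def)
    then have "i \<le> n" "int i = 2 * int j - 1" using j by auto
    then have "lo n i = - (int n + 2 - 2 * int j)" "hi n i = int n + 2 - 2 * int j + 1"
      by (auto simp: lo_def hi_def)
    then show thesis using pair[of "int n + 2 - 2 * int j"] j odd_n by simp
  next
    assume l: "l > 0" and i: "i \<in> {n + 1 - l..n + 1}"
    show thesis
    proof (cases "i = n + 1")
      case True
      then show thesis using sign l by (simp add: lo_def hi_def)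
    next
      case False
      then show thesis using inner[of "int n + 1 - int i"] l i
        by (simp add: lo_def hi_def) linarith
    qed
  qed
qed

text \<open>For even \<open>l\<close> the coordinate 1 is not negated, but its value is outweighed
  by \<open>cfun k l 2 = - 2\<close>, so both ends of the fork are still descents.\<close>

lemma cfun_descent:
  assumes "admissible k l" "i \<in> I_set n k l"
  shows "descent (cfun k l) i"
  using assms
proof (cases rule: I_set_cases)
  case (pair c)
  moreover have "c \<ge> 1" using pair assms(1) by (auto simp: admissible_def)
  ultimately have "cfun k l (- c) = pair_swap (- c)" "cfun k l (c + 1) = pair_swap (c + 1)"
    by (simp_all add: cfun_def)
  then show ?thesis using pair \<open>c \<ge> 1\<close> by (simp add: pair_swap_def)
next
  case sign
  then have kl: "2 * k + l \<le> n" using assms(1) by (auto simp: admissible_def)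
  then have "cfun k l 1 = (if odd l then - 1 else 1)" "cfun k l 2 = - 2" using sign
    by (auto simp: cfun_def)
  then show ?thesis using sign by simp
next
  case (inner c)
  then have kl: "2 * k + l \<le> n" using assms(1) by (auto simp: admissible_def)
  then have "cfun k l (- c) = (if odd l \<or> c \<ge> 2 then c else - c)" "cfun k l (c + 1) = - (c + 1)"
    using inner by (auto simp: cfun_def)
  then show ?thesis using inner by simp
qed

lemma cfun_parabolic:
  assumes "admissible k l"
  shows "cfun k l \<in> parabolic_perms (I_set n k l)"
proof -
  have "coweight n t (cfun k l x) = coweight n t x" if t: "t \<in> S" "t \<notin> I_set n k l" for t x
  proof -
    have tn: "1 \<le> t" "t \<le> n + 1" using t by (auto simp: D_nodes_def)
    have tl: "l = 0 \<or> t < n + 1 - l" using t(2) tn by (auto simp: I_set_def J_set_def split: if_splits)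
    have tk: "even t \<or> 2 * k < t + 1"
    proof (rule ccontr)
      assume "\<not> ?thesis"
      then have "odd t" "t + 1 \<le> 2 * k" by auto
      then have "t = 2 * ((t + 1) div 2) - 1" "1 \<le> (t + 1) div 2" "(t + 1) div 2 \<le> k" using tn by auto
      then have "t \<in> {2 * i - 1 |i. 1 \<le> i \<and> i \<le> k}" by blast
      with t(2) show False unfolding I_set_def by blast
    qed
    from assms show ?thesis
    proof (cases rule: cfun_cases[where x = x])
      case swap
      show ?thesis
      proof (cases "t < n")
        case True
        \<comment> \<open>The threshold of this coweight does not cut a swapped pair: it is odd only
          if it lies below the whole swapped block.\<close>
        have "int n + 1 - int t < \<bar>pair_swap x\<bar> \<longleftrightarrow> int n + 1 - int t < \<bar>x\<bar>"
        proof (cases "even t")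
          case True
          then show ?thesis using abs_pair_swap_le[OF swap(4), of "int n + 1 - int t"] odd_n by auto
        next
          case False
          then have "int n + 1 - int t < int n + 2 - 2 * int k" using tk by auto
          then show ?thesis using swap cfun_pair_swap_range(1)[OF swap(4), of k] by linarith
        qed
        then show ?thesis using swap True sgn_pair_swap[OF swap(4)] by (simp add: coweight_def)
      next
        case False
        \<comment> \<open>The coweight of \<open>n\<close> singles out the coordinate 1, which is
          not swapped when \<open>n\<close> is outside \<open>I_set n k l\<close>.\<close>
        have "\<bar>pair_swap x\<bar> = 1 \<longleftrightarrow> \<bar>x\<bar> = 1" if "t = n"
        proof -
          have "2 * k < n + 1" using tk that odd_n by simp
          then have "2 * k + 1 \<le> n" using odd_n by presburger
          then have "int n + 2 - 2 * int k > 1" by linarith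
          then show ?thesis using swap cfun_pair_swap_range(1)[OF swap(4), of k] by linarith
        qed
        then show ?thesis using False tn swap sgn_pair_swap[OF swap(4)] by (auto simp: coweight_def)
      qed
    next
      case neg
      then have "t < n + 1 - l" using tl by simp
      then have "t < n" "\<not> int n + 1 - int t < \<bar>x\<bar>" using neg by linarith+
      then show ?thesis using neg(3) by (simp add: coweight_def)
    qed simp
  qed
  then show ?thesis using cfun_even[OF assms] by (simp add: parabolic_perms_def)
qed

lemma c_inv_eq: "admissible k l \<Longrightarrow> c_inv n k l = elt (cfun k l)"
  unfolding c_inv_def
  using longest_element_eq[OF I_set_subset cfun_parabolic] cfun_descent by blast

section \<open>The involutions without fixed or negated coordinates\<close>

abbreviation half :: nat where "half \<equiv> Suc n div 2"

lemma admissible_half: "admissible half 0"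
  using odd_n by (simp add: admissible_def)

lemma two_half: "2 * half = n + 1"
  using odd_n by simp

lemma cfun_half: "cfun half 0 x = (if 1 \<le> \<bar>x\<bar> \<and> \<bar>x\<bar> \<le> int n + 1 then pair_swap x else x)"
proof -
  have "int n + 2 - 2 * int half = 1" using two_half by linarith
  then show ?thesis by (simp add: cfun_def)
qed

lemma odd_nodes: "{i. odd i \<and> i \<le> n - 2} = {2 * i - 1 |i. 1 \<le> i \<and> i \<le> half - 1}"
proof (intro equalityI subsetI)
  fix i assume "i \<in> {i. odd i \<and> i \<le> n - 2}"
  then have "odd i" "i \<le> n - 2" by auto
  then have "i = 2 * ((i + 1) div 2) - 1" "1 \<le> (i + 1) div 2" "(i + 1) div 2 \<le> half - 1"
    using odd_n n3 by presburger+
  then show "i \<in> {2 * i - 1 |i. 1 \<le> i \<and> i \<le> half - 1}" by blast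
next
  fix i assume "i \<in> {2 * i - 1 |i. 1 \<le> i \<and> i \<le> half - 1}"
  then obtain j where "i = 2 * j - 1" "1 \<le> j" "j \<le> half - 1" by blast
  then have "odd i \<and> i \<le> n - 2" using two_half by auto
  then show "i \<in> {i. odd i \<and> i \<le> n - 2}" by simp
qed

lemma c_minus_eq: "c_minus n = elt (cfun half 0)"
proof -
  have "{i. odd i \<and> i \<le> n - 2} \<union> {n} = I_set n half 0"
  proof -
    have "{2 * i - 1 |i. 1 \<le> i \<and> i \<le> half} = {2 * i - 1 |i. 1 \<le> i \<and> i \<le> half - 1} \<union> {2 * half - 1}"
    proof -
      have "1 \<le> half" using two_half by simp
      then have "1 \<le> i \<and> i \<le> half \<longleftrightarrow> 1 \<le> i \<and> i \<le> half - 1 \<or> i = half" for i by linarith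
      then show ?thesis by blast
    qed
    moreover have "2 * half - 1 = n" using two_half by simp
    ultimately have "{2 * i - 1 |i. 1 \<le> i \<and> i \<le> half - 1} \<union> {n} = {2 * i - 1 |i. 1 \<le> i \<and> i \<le> half}"
      by simp
    then show ?thesis unfolding odd_nodes by (simp add: I_set_def J_set_def)
  qed
  then show ?thesis using c_inv_eq[OF admissible_half] by (simp add: c_minus_def c_inv_def)
qed

lemma cfun_signed: "admissible k l \<Longrightarrow> cfun k l \<in> signed_perms N"
  using cfun_even even_signed_permsD by blast

lemma flip_one_N: "flip_one \<in> signed_perms N" "signature N flip_one = - 1"
  using flip_one_signed[of N] signature_flip_one[of N] by simp_all

text \<open>Conjugation by \<open>flip_one\<close> is the diagram automorphism exchanging the nodes
  \<open>n\<close> and \<open>n + 1\<close>.\<close>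

definition cplus_fun :: "int \<Rightarrow> int" where
  "cplus_fun = flip_one \<circ> cfun half 0 \<circ> flip_one"

lemma cplus_fun_even: "cplus_fun \<in> even_signed_perms N"
  using cfun_even[OF admissible_half] flip_one_N
  by (simp add: cplus_fun_def even_signed_perms_def signed_perms_comp signature_comp)

lemma c_plus_eq: "c_plus n = elt cplus_fun"
proof -
  let ?I = "{i. odd i \<and> i \<le> n - 2} \<union> {n + 1}"
  have "coweight n t (cplus_fun x) = coweight n t x" if t: "t \<in> S - ?I" for t x
  proof -
    have inv: "coweight n t (cfun half 0 x) = coweight n t x" if "t \<in> S" "even t" for t x
    proof -
      have "t \<notin> I_set n half 0" using that by (auto simp: I_set_def J_set_def)
      then show ?thesis using cfun_parabolic[OF admissible_half] that by (simp add: parabolic_perms_def)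
    qed
    show ?thesis
    proof (cases "t = n")
      case True
      have flip: "coweight n n (flip_one x) = coweight n (n + 1) x" "coweight n (n + 1) (flip_one x) = coweight n n x" for x
        by (auto simp: coweight_def flip_one_def)
      have "coweight n (n + 1) (cfun half 0 y) = coweight n (n + 1) y" for y
        by (rule inv) (use odd_n in \<open>auto simp: D_nodes_def\<close>)
      then show ?thesis using True by (simp only: cplus_fun_def comp_apply flip)
    next
      case False
      have "even t" "t < n"
      proof -
        have "t \<le> n" using t False by (auto simp: D_nodes_def)
        then show "t < n" using False by simp
        have "n - 2 < t \<or> even t" using t by auto
        moreover have "n - 2 < t \<Longrightarrow> t = n - 1" using \<open>t < n\<close> by simp
        ultimately show "even t" using odd_n by auto
      qed
      then have flip: "coweight n t (flip_one y) = coweight n t y" for y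
        by (auto simp: coweight_def flip_one_def)
      have "coweight n t (cfun half 0 y) = coweight n t y" for y
        by (rule inv) (use t \<open>even t\<close> in auto)
      then show ?thesis by (simp only: cplus_fun_def comp_apply flip)
    qed
  qed
  then have par: "cplus_fun \<in> parabolic_perms ?I" using cplus_fun_even by (simp add: parabolic_perms_def)
  have "descent cplus_fun i" if i: "i \<in> ?I" for i
  proof (cases "i = n + 1")
    case True
    have "cfun half 0 (- 1) = - 2" "cfun half 0 2 = 1"
      unfolding cfun_half using n3 by (simp_all add: pair_swap_def)
    then show ?thesis using True by (simp add: lo_def hi_def cplus_fun_def flip_one_def)
  next
    case False
    then have "odd i" "i \<le> n - 2" using i by auto
    then have "i \<in> {2 * i - 1 |i. 1 \<le> i \<and> i \<le> half - 1}" unfolding odd_nodes[symmetric] by simp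
    then obtain j where "i = 2 * j - 1" "1 \<le> j" "j \<le> half - 1" by blast
    then have "i = 2 * j - 1 \<and> 1 \<le> j \<and> j \<le> half" by simp
    then have "i \<in> I_set n half 0" unfolding I_set_def by blast
    then have d: "descent (cfun half 0) i" using cfun_descent[OF admissible_half] by blast
    \<comment> \<open>These roots involve only coordinates from 3 on. The partner of 1 is 2, so the
      swap does not lead back to the flipped coordinate.\<close>
    have lh: "lo n i = - (int n + 1 - int i)" "hi n i = int n + 2 - int i" "int n + 1 - int i \<ge> 3"
      using \<open>i \<le> n - 2\<close> n3 by (auto simp: lo_def hi_def)
    then have "flip_one (lo n i) = lo n i" "flip_one (hi n i) = hi n i" by (auto simp: flip_one_def)
    moreover have "\<bar>cfun half 0 x\<bar> \<noteq> 1" if "\<bar>x\<bar> \<ge> 3" for x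
    proof -
      have "x \<noteq> 0" using that by auto
      then have "\<bar>pair_swap x\<bar> \<ge> 3" using that abs_pair_swap_ge[of x 3] by simp
      then show ?thesis using that by (simp add: cfun_half)
    qed
    then have "flip_one (cfun half 0 (lo n i)) = cfun half 0 (lo n i)" "flip_one (cfun half 0 (hi n i)) = cfun half 0 (hi n i)"
      using lh by (auto simp: flip_one_def)
    ultimately show ?thesis using d by (simp add: cplus_fun_def)
  qed
  moreover have "?I \<subseteq> S"
  proof -
    have "1 \<le> i \<and> i \<le> n + 1" if "odd i" "i \<le> n - 2" for i
      using odd_pos[OF that(1)] that(2) by linarith
    then show ?thesis by (auto simp: D_nodes_def)
  qed
  ultimately show ?thesis
    unfolding c_plus_def using longest_element_eq[OF _ par] by blast
qed

end

section \<open>The classification\<close>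

lemma reflect_uminus_uminus: "root N a b \<Longrightarrow> reflect (- a) (- b) = reflect a b"
  by (drule rootD) (auto simp: reflect_def fun_eq_iff)

context odd_type_D
begin

text \<open>The bound keeps the coordinate 1 out of the swapped block, so it is fixed or negated.
  This is what later repairs the parity of a conjugator.\<close>

lemma flip_one_cfun:
  assumes "2 * k + l \<le> n"
  shows "cfun k l (flip_one x) = flip_one (cfun k l x)"
proof -
  have adm: "admissible k l" using assms by (simp add: admissible_def)
  interpret signed_involution N "cfun k l" by (rule cfun_signed_involution[OF adm])
  have "\<bar>cfun k l x\<bar> = 1" if "\<bar>x\<bar> = 1" for x
    using assms that by (auto simp: cfun_def)
  then have "\<bar>cfun k l x\<bar> = 1 \<longleftrightarrow> \<bar>x\<bar> = 1" using w_w by metis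
  then show ?thesis by (simp add: flip_one_def w_neg)
qed

lemma conjugate_cfun:
  assumes v: "v \<in> even_signed_perms N" "signed_involution N v" and kl: "2 * k + l \<le> n"
    and neg: "card (negated_coords N v) = (if odd l then l + 1 else l)"
    and lead: "card (leading_coords N v) = k"
  shows "conjugate_in W (elt v) (elt (cfun k l))"
proof -
  have adm: "admissible k l" using kl by (simp add: admissible_def)
  obtain h where h: "h \<in> signed_perms N" "cfun k l \<circ> h = h \<circ> v"
    using signed_involutions_conjugate[OF v(2) cfun_signed_involution[OF adm]]
      card_negated_cfun[OF adm] card_leading_cfun[OF adm] neg lead by auto
  have "\<exists>g\<in>even_signed_perms N. cfun k l \<circ> g = g \<circ> v"
  proof (cases "signature N h = 1")
    case True
    then show ?thesis using h by (auto simp: even_signed_perms_def)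
  next
    case False
    then have "flip_one \<circ> h \<in> even_signed_perms N"
      using h(1) signature_cases[OF h(1)] flip_one_N
      by (simp add: even_signed_perms_def signed_perms_comp signature_comp)
    moreover have "cfun k l \<circ> (flip_one \<circ> h) = (flip_one \<circ> h) \<circ> v"
      using h(2) flip_one_cfun[OF kl] by (simp add: fun_eq_iff)
    ultimately show ?thesis by blast
  qed
  then show ?thesis using conjugate_elt[OF v(1) cfun_even[OF adm]] by blast
qed

text \<open>The elements of the centralizer of \<open>c_minus\<close> in the group of all signed permutations change
  the signs of whole pairs of coordinates.\<close>

lemma centralizer_cfun_half:
  assumes u: "u \<in> signed_perms N" and comm: "u \<circ> cfun half 0 = cfun half 0 \<circ> u"
  shows "signature N u = 1"
proof -
  let ?c = "cfun half 0"
  have pos: "?c x > 0 \<longleftrightarrow> x > 0" "?c x < 0 \<longleftrightarrow> x < 0" for x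
  proof -
    have "sgn (?c x) = sgn x" using sgn_pair_swap[of x] by (auto simp: cfun_half)
    then show "?c x > 0 \<longleftrightarrow> x > 0" "?c x < 0 \<longleftrightarrow> x < 0" by (metis sgn_greater sgn_less)+
  qed
  have "even (card {x \<in> {1..int N}. u x < 0})"
  \<comment> \<open>The map \<open>?c\<close> preserves signs and commutes with \<open>u\<close>, so
    it pairs off the coordinates whose sign \<open>u\<close> changes.\<close>
  proof (rule even_card_fixpoint_free[where f = ?c])
    show "finite {x \<in> {1..int N}. u x < 0}" by (rule finite_subset[of _ "{1..int N}"]) auto
    fix x assume x: "x \<in> {x \<in> {1..int N}. u x < 0}"
    have "u (?c x) = ?c (u x)" using comm by (simp add: fun_eq_iff)
    moreover have "?c x \<in> {1..int N}"
      using x pos(1)[of x] signed_perms_in[OF cfun_signed[OF admissible_half], of x] unfolding coords_pos_iff by simp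
    ultimately show "?c x \<in> {x \<in> {1..int N}. u x < 0}" using x pos(2)[of "u x"] by simp
    show "?c (?c x) = x" by (rule cfun_cfun[OF admissible_half])
    show "?c x \<noteq> x" using x by (simp add: cfun_half pair_swap_def)
  qed
  then show ?thesis using signature_card[OF u] by simp
qed

lemma involution_classification:
  assumes x: "involution W x"
  shows "(\<exists>l k. l \<le> n \<and> k \<le> (n - l) div 2 \<and> conjugate_in W x (c_inv n k l)) \<or>
    (conjugate_in W x (c_minus n) \<noteq> conjugate_in W x (c_plus n))"
proof -
  obtain v where v: "v \<in> even_signed_perms N" "x = elt v" using x by (auto simp: involution_def carrier_W)
  then have vv: "v \<circ> v = id" using x involution_elt by simp
  have inv: "signed_involution N v" using even_signed_permsD[OF v(1)] vv by unfold_locales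
  interpret signed_involution N v by (rule inv)
  let ?f = "card (fixed_coords N v)" and ?m = "card (negated_coords N v)" and ?q = "card (leading_coords N v)"
  have sum: "?f + ?m + 2 * ?q = n + 1" using card_coords by simp
  have m_even: "even ?m" using even_card_negated[OF inv v(1)] .
  show ?thesis
  proof (cases "?f = 0 \<and> ?m = 0")
    case False
    \<comment> \<open>The subtraction is truncated: \<open>l = 0\<close> if nothing is negated, and
      otherwise \<open>l\<close> is odd because \<open>?m\<close> is even.\<close>
    define l where "l = ?m - 1"
    have l: "(if odd l then l + 1 else l) = ?m" using m_even by (cases "?m = 0") (auto simp: l_def)
    have "2 * ?q + l \<le> n"
    proof (cases "?m = 0")
      case True
      then show ?thesis using False sum by (simp add: l_def)
    qed (use sum in \<open>simp add: l_def\<close>)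
    then have "l \<le> n" "?q \<le> (n - l) div 2" "admissible ?q l" "conjugate_in W x (elt (cfun ?q l))"
      using conjugate_cfun[OF v(1) inv _ l[symmetric] HOL.refl] v(2) by (auto simp: admissible_def)
    then show ?thesis using c_inv_eq by metis
  next
    case True
    let ?c = "cfun half 0"
    have q: "?q = half" using True sum by simp
    obtain h where h: "h \<in> signed_perms N" "?c \<circ> h = h \<circ> v"
      using signed_involutions_conjugate[OF inv cfun_signed_involution[OF admissible_half]]
        card_negated_cfun[OF admissible_half] card_leading_cfun[OF admissible_half] True q by auto
    have minus: "conjugate_in W x (c_minus n) \<longleftrightarrow> (\<exists>g\<in>even_signed_perms N. ?c \<circ> g = g \<circ> v)"
      unfolding c_minus_eq v(2) by (rule conjugate_elt[OF v(1) cfun_even[OF admissible_half]])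
    have plus: "conjugate_in W x (c_plus n) \<longleftrightarrow> (\<exists>g\<in>even_signed_perms N. cplus_fun \<circ> g = g \<circ> v)"
      unfolding c_plus_eq v(2) by (rule conjugate_elt[OF v(1) cplus_fun_even])
    have "conjugate_in W x (c_minus n) \<or> conjugate_in W x (c_plus n)"
    proof (cases "signature N h = 1")
      case True
      then show ?thesis using h minus by (auto simp: even_signed_perms_def)
    next
      case False
      then have "flip_one \<circ> h \<in> even_signed_perms N"
        using h(1) signature_cases[OF h(1)] flip_one_N
        by (simp add: even_signed_perms_def signed_perms_comp signature_comp)
      moreover have "cplus_fun \<circ> (flip_one \<circ> h) = (flip_one \<circ> h) \<circ> v"
        using h(2) by (simp add: fun_eq_iff cplus_fun_def)
      ultimately show ?thesis using plus by blast
    qed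
    moreover have "\<not> (conjugate_in W x (c_minus n) \<and> conjugate_in W x (c_plus n))"
    proof
      assume "conjugate_in W x (c_minus n) \<and> conjugate_in W x (c_plus n)"
      then obtain g1 g2 where g: "g1 \<in> even_signed_perms N" "?c \<circ> g1 = g1 \<circ> v"
        "g2 \<in> even_signed_perms N" "cplus_fun \<circ> g2 = g2 \<circ> v" using minus plus by blast
      note g1 = even_signed_permsD[OF g(1)] and g2 = even_signed_permsD[OF g(3)]
      let ?i = "inv_into UNIV g1"
      \<comment> \<open>Two even conjugators combine with \<open>flip_one\<close> to an element that
        centralizes \<open>?c\<close> but is odd.\<close>
      let ?u = "flip_one \<circ> (g2 \<circ> ?i)"
      have i: "?i \<in> signed_perms N" "signature N ?i = 1"
        using even_signed_perms_inv[OF g(1)] by (simp_all add: even_signed_perms_def)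
      have "?u (?c y) = ?c (?u y)" for y
      proof -
        have "g1 (v (?i y)) = ?c y"
          using fun_cong[OF g(2), of "?i y"] signed_perms_inv_comp(4)[OF g1, of y] by simp
        then have "?i (?c y) = v (?i y)" using signed_perms_inv_comp(3)[OF g1] by metis
        moreover have "flip_one (g2 (v z)) = ?c (flip_one (g2 z))" for z
          using fun_cong[OF g(4), of z, symmetric] by (simp add: cplus_fun_def)
        ultimately show ?thesis by simp
      qed
      then have "signature N ?u = 1"
        using g2 i flip_one_N by (intro centralizer_cfun_half signed_perms_comp) auto
      moreover have "signature N ?u = - 1"
        using g2 i flip_one_N g(3) by (simp add: signature_comp signed_perms_comp even_signed_perms_def)
      ultimately show False by simp
    qed
    ultimately show ?thesis by blast
  qed
qed

text \<open>Under this parity condition the involution sends each simple root in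
  \<open>I_set n k l\<close> to its negative, which has the same reflection. For a swapped pair the
  two coordinates of the root are exchanged as well.\<close>

lemma cfun_commutes:
  assumes kl: "2 * k + l \<le> n" "odd l \<or> l = 0" and i: "i \<in> I_set n k l"
  shows "cfun k l \<circ> node_perm n i = node_perm n i \<circ> cfun k l"
proof -
  have adm: "admissible k l" using kl by (simp add: admissible_def)
  have iS: "i \<in> S" using i I_set_subset[OF adm] by blast
  note r = root_node[OF iS]
  have r': "root N (hi n i) (lo n i)" using r by (subst root_commute)
  from adm i have "cfun k l (lo n i) = - lo n i \<and> cfun k l (hi n i) = - hi n i \<or>
    cfun k l (lo n i) = - hi n i \<and> cfun k l (hi n i) = - lo n i"
  proof (cases rule: I_set_cases)
    case (pair c)
    moreover have "c \<ge> 1" using pair kl by auto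
    ultimately show ?thesis by (simp add: cfun_def pair_swap_def)
  next
    case sign
    then show ?thesis using kl by (auto simp: cfun_def)
  next
    case (inner c)
    then show ?thesis using kl by (auto simp: cfun_def)
  qed
  then have "reflect (cfun k l (lo n i)) (cfun k l (hi n i)) = node_perm n i"
    using reflect_uminus_uminus[OF r] reflect_uminus_uminus[OF r'] reflect_sym[OF r]
    by (auto simp: node_perm_def)
  then show ?thesis
    using reflect_conj[OF cfun_signed[OF adm] r] by (simp add: node_perm_def)
qed

text \<open>For \<open>l = 0\<close> the generators in \<open>I_set n k 0\<close> commute pairwise,
  hence the second alternative. For even \<open>l \<ge> 2\<close> every possible \<open>I\<close>
  has to be excluded: \<open>n + 1\<close> must belong to \<open>I\<close>, since 2 goes to -2 and
  the coweight of \<open>n + 1\<close> changes, yet it cannot, since 1 is fixed while 2 is negated,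
  and so its reflection does not commute with the involution.\<close>

lemma standard_iff:
  assumes kl: "2 * k + l \<le> n"
  shows "standard_involution S (D_matrix n) (c_inv n k l) \<longleftrightarrow> odd l \<or> l = 0"
proof
  have adm: "admissible k l" using kl by (simp add: admissible_def)
  note c = cfun_even[OF adm]
  {
    assume l: "odd l \<or> l = 0"
    have "cfun k l \<circ> u = u \<circ> cfun k l" if "u \<in> parabolic_perms (I_set n k l)" for u
      using that
    proof (induction rule: parabolic_perms_induct)
      case (comp v i)
      have "cfun k l \<circ> (v \<circ> node_perm n i) = v \<circ> (cfun k l \<circ> node_perm n i)"
        using comp(4) by (metis comp_assoc)
      then show ?case using cfun_commutes[OF kl l comp(2)] by (metis comp_assoc)
    qed simp
    then have "elt (cfun k l) \<otimes>\<^bsub>W\<^esub> y = y \<otimes>\<^bsub>W\<^esub> elt (cfun k l)" if "y \<in> parabolic S (D_matrix n) (I_set n k l)" for y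
      using that elt_mult c parabolic_perms_even by (auto simp: parabolic_eq[OF I_set_subset[OF adm]])
    then show "standard_involution S (D_matrix n) (c_inv n k l)"
      unfolding standard_involution_def using I_set_subset[OF adm] c_inv_eq[OF adm] c_inv_def by metis
  next
    assume "standard_involution S (D_matrix n) (c_inv n k l)"
    then obtain I where I: "I \<subseteq> S" "elt (cfun k l) = longest_element S (D_matrix n) I"
      "\<And>y. y \<in> parabolic S (D_matrix n) I \<Longrightarrow> elt (cfun k l) \<otimes>\<^bsub>W\<^esub> y = y \<otimes>\<^bsub>W\<^esub> elt (cfun k l)"
      unfolding standard_involution_def c_inv_eq[OF adm] by blast
    obtain w where w: "w \<in> parabolic_perms I" "elt (cfun k l) = elt w"
      using longest_element_exists[OF I(1)] I(2) by metis
    then have par: "cfun k l \<in> parabolic_perms I" using elt_inj[OF c] by simp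
    show "odd l \<or> l = 0"
    proof (rule ccontr)
      assume "\<not> ?thesis"
      then have l: "even l" "l \<ge> 2" by presburger+
      have vals: "cfun k l 1 = 1" "cfun k l 2 = - 2" "cfun k l (- 2) = 2"
        using l kl by (auto simp: cfun_def)
      have nS: "n + 1 \<in> S" by (simp add: D_nodes_def)
      have "n + 1 \<notin> I"
      proof
        assume nI: "n + 1 \<in> I"
        then have "elt (node_perm n (n + 1)) \<in> parabolic S (D_matrix n) I"
          using node_perm_parabolic[OF nI nS] by (simp add: parabolic_eq[OF I(1)])
        from I(3)[OF this] have "cfun k l \<circ> node_perm n (n + 1) = node_perm n (n + 1) \<circ> cfun k l"
          using elt_mult[OF c node_perm_even[OF nS]] elt_mult[OF node_perm_even[OF nS] c]
            elt_inj[OF even_signed_perms_comp[OF c node_perm_even[OF nS]]] by metis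
        then have "cfun k l (node_perm n (n + 1) 1) = node_perm n (n + 1) (cfun k l 1)"
          by (metis comp_apply)
        moreover have "node_perm n (n + 1) 1 = - 2"
          by (simp add: node_perm_def reflect_def lo_def hi_def)
        ultimately show False using vals by simp
      qed
      then have "coweight n (n + 1) (cfun k l 2) = coweight n (n + 1) 2"
        using par nS by (simp add: parabolic_perms_def)
      then show False using vals by (simp add: coweight_def)
    qed
  }
qed

text \<open>Both involutions negate \<open>l\<close> coordinates and swap \<open>k\<close> pairs;
  they differ only in whether the coordinate 1 is among the negated ones.\<close>

lemma conjugate_pred:
  assumes kl: "2 * k + l \<le> n" and l: "even l" "l \<ge> 2"
  shows "conjugate_in W (c_inv n k l) (c_inv n k (l - 1))"
proof -
  have adm: "admissible k l" "admissible k (l - 1)" using kl by (auto simp: admissible_def)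
  have "odd (l - 1)" "l - 1 + 1 = l" using l by auto
  then have "conjugate_in W (elt (cfun k l)) (elt (cfun k (l - 1)))"
    using card_negated_cfun[OF adm(1)] card_leading_cfun[OF adm(1)] kl l
    by (intro conjugate_cfun cfun_even cfun_signed_involution adm) auto
  then show ?thesis by (simp only: c_inv_eq adm)
qed

section \<open>Multiplication by the longest element\<close>

abbreviation negate :: "int \<Rightarrow> int" where "negate \<equiv> cfun 0 n"

lemma admissible_negate: "admissible 0 n"
  by (simp add: admissible_def)

lemma negate_eq: "negate x = (if x \<in> coords N then - x else x)"
  using odd_n by (auto simp: cfun_def coords_def)

lemma w_o_eq: "w_o n = elt negate"
proof -
  have "I_set n 0 n = S" using n3 by (auto simp: I_set_def J_set_def D_nodes_def)
  then show ?thesis using c_inv_eq[OF admissible_negate] by (simp add: w_o_def c_inv_def)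
qed

lemma negate_comp:
  assumes "signed_involution N w" "w \<in> even_signed_perms N"
  shows "w_o n \<otimes>\<^bsub>W\<^esub> elt w = elt (negate \<circ> w)" "signed_involution N (negate \<circ> w)"
    "negate \<circ> w \<in> even_signed_perms N"
    "negated_coords N (negate \<circ> w) = fixed_coords N w"
    "leading_coords N (negate \<circ> w) = leading_coords N w"
proof -
  interpret signed_involution N w by fact
  note neg_even = cfun_even[OF admissible_negate]
  show "w_o n \<otimes>\<^bsub>W\<^esub> elt w = elt (negate \<circ> w)"
    unfolding w_o_eq by (rule elt_mult[OF neg_even assms(2)])
  show "negate \<circ> w \<in> even_signed_perms N" by (rule even_signed_perms_comp[OF neg_even assms(2)])
  then show "signed_involution N (negate \<circ> w)"
    by unfold_locales (auto simp: fun_eq_iff negate_eq w_neg w_w signed_perms_in[OF signed] even_signed_permsD)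
  have "x \<in> {1..int N} \<Longrightarrow> (negate \<circ> w) x = - w x" for x
    using signed_perms_in[OF signed, of x] unfolding coords_pos_iff by (simp add: negate_eq)
  then have "x \<in> negated_coords N (negate \<circ> w) \<longleftrightarrow> x \<in> fixed_coords N w"
    "x \<in> leading_coords N (negate \<circ> w) \<longleftrightarrow> x \<in> leading_coords N w" for x
    unfolding negated_coords_def fixed_coords_def leading_coords_def by force+
  then show "negated_coords N (negate \<circ> w) = fixed_coords N w"
    "leading_coords N (negate \<circ> w) = leading_coords N w" by blast+
qed

lemma conjugate_negate_cfun:
  assumes kl: "2 * k + l \<le> n"
  shows "conjugate_in W (w_o n \<otimes>\<^bsub>W\<^esub> c_inv n k l) (c_inv n k (n - 2 * k - l))"
proof -
  let ?l = "n - 2 * k - l"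
  have adm: "admissible k l" "admissible k ?l" using kl by (auto simp: admissible_def)
  note inv = cfun_signed_involution[OF adm(1)]
  interpret signed_involution N "cfun k l" by (rule inv)
  note nc = negate_comp[OF inv cfun_even[OF adm(1)]]
  \<comment> \<open>As \<open>n\<close> is odd, the two parameters have opposite parity, so exactly
    one of them is rounded up and the two numbers of negated coordinates add up to
    \<open>n + 1 - 2 * k\<close>.\<close>
  have "odd ?l \<longleftrightarrow> even l" using kl odd_n by simp
  then have "card (fixed_coords N (cfun k l)) = (if odd ?l then ?l + 1 else ?l)"
    using card_coords card_negated_cfun[OF adm(1)] card_leading_cfun[OF adm(1)] kl
    by (auto split: if_splits)
  then have "conjugate_in W (elt (negate \<circ> cfun k l)) (elt (cfun k ?l))"
    using card_leading_cfun[OF adm(1)] kl nc by (intro conjugate_cfun) simp_all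
  then show ?thesis by (simp only: c_inv_eq[OF adm(1)] c_inv_eq[OF adm(2)] nc(1))
qed

text \<open>Negates one member of each pair of \<open>pair_swap\<close>. Conjugation by it turns
  every exchange of \<open>2 j - 1\<close> and \<open>2 j\<close> into its negative.\<close>

definition negate_odd :: "int \<Rightarrow> int" where
  "negate_odd x = (if odd x \<and> x \<in> coords N then - x else x)"

lemma negate_odd_signed: "negate_odd \<in> signed_perms N"
  by (rule signed_perms_involutionI) (auto simp: negate_odd_def)

lemma signature_negate_odd: "signature N negate_odd = (- 1) ^ half"
proof -
  have "{x \<in> {1..int N}. negate_odd x < 0} = (\<lambda>j. 2 * int j - 1) ` {1..half}"
  proof (intro equalityI subsetI)
    fix x assume "x \<in> {x \<in> {1..int N}. negate_odd x < 0}"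
    then have x: "1 \<le> x" "x \<le> int N" "odd x" by (auto simp: negate_odd_def split: if_splits)
    obtain m where m: "x = 2 * m + 1" using x(3) by (elim oddE)
    define j where "j = nat (m + 1)"
    have "2 * int j = x + 1" using x(1) m by (simp add: j_def)
    then have "x = 2 * int j - 1" "j \<in> {1..half}" using x two_half by auto
    then show "x \<in> (\<lambda>j. 2 * int j - 1) ` {1..half}" by blast
  next
    fix x assume "x \<in> (\<lambda>j. 2 * int j - 1) ` {1..half}"
    then obtain j where "x = 2 * int j - 1" "1 \<le> j" "j \<le> half" by auto
    then have "1 \<le> x" "x \<le> int N" "odd x" using two_half by auto
    then show "x \<in> {x \<in> {1..int N}. negate_odd x < 0}" by (simp add: negate_odd_def coords_def)
  qed
  moreover have "inj_on (\<lambda>j. 2 * int j - 1) {1..half}" by (auto simp: inj_on_def)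
  ultimately show ?thesis using signature_card[OF negate_odd_signed] by (simp add: card_image)
qed

lemma cfun_half_negate_odd: "cfun half 0 (negate_odd x) = negate_odd (negate (cfun half 0 x))"
proof (cases "x \<in> coords N")
  case True
  interpret signed_involution N "cfun half 0" by (rule cfun_signed_involution[OF admissible_half])
  have "cfun half 0 x \<in> coords N" using True signed_perms_in[OF signed] by simp
  moreover have "odd (cfun half 0 x) \<longleftrightarrow> even x" using True by (auto simp: cfun_half pair_swap_def coords_def)
  ultimately show ?thesis using True w_neg by (simp add: negate_odd_def negate_eq)
next
  case False
  then have "cfun half 0 x = x" using signed_perms_fix[OF cfun_signed[OF admissible_half]] by blast
  then show ?thesis using False by (simp add: negate_odd_def negate_eq)
qed

lemma flip_one_negate: "flip_one (negate x) = negate (flip_one x)"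
  by (auto simp: negate_eq flip_one_def)

lemma flip_one_negate_odd: "flip_one (negate_odd x) = negate_odd (flip_one x)"
  by (auto simp: negate_odd_def flip_one_def)

text \<open>For even \<open>half\<close> the conjugator is \<open>negate_odd\<close> itself. For odd
  \<open>half\<close> it lies outside the group and is composed with \<open>flip_one\<close>, which
  carries each of the two classes to the other.\<close>

lemma conjugate_negate_c_minus_plus:
  shows "even half \<Longrightarrow> conjugate_in W (w_o n \<otimes>\<^bsub>W\<^esub> c_minus n) (c_minus n)"
    "even half \<Longrightarrow> conjugate_in W (w_o n \<otimes>\<^bsub>W\<^esub> c_plus n) (c_plus n)"
    "odd half \<Longrightarrow> conjugate_in W (w_o n \<otimes>\<^bsub>W\<^esub> c_minus n) (c_plus n)"
    "odd half \<Longrightarrow> conjugate_in W (w_o n \<otimes>\<^bsub>W\<^esub> c_plus n) (c_minus n)"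
proof -
  let ?c = "cfun half 0"
  note c = cfun_even[OF admissible_half]
  note neg = cfun_even[OF admissible_negate]
  have mult: "w_o n \<otimes>\<^bsub>W\<^esub> elt w = elt (negate \<circ> w)" "negate \<circ> w \<in> even_signed_perms N"
    if "w \<in> even_signed_perms N" for w
    unfolding w_o_eq using elt_mult[OF neg that] even_signed_perms_comp[OF neg that] by auto
  note conj = conjugate_elt[OF mult(2)]
  {
    assume "even half"
    then have h: "negate_odd \<in> even_signed_perms N"
      using negate_odd_signed signature_negate_odd by (simp add: even_signed_perms_def)
    have "?c \<circ> negate_odd = negate_odd \<circ> (negate \<circ> ?c)" by (simp add: fun_eq_iff cfun_half_negate_odd)
    then show "conjugate_in W (w_o n \<otimes>\<^bsub>W\<^esub> c_minus n) (c_minus n)"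
      unfolding c_minus_eq mult(1)[OF c] using conj[OF c c] h by blast
    have "cplus_fun \<circ> negate_odd = negate_odd \<circ> (negate \<circ> cplus_fun)"
      by (simp add: fun_eq_iff cplus_fun_def cfun_half_negate_odd flip_one_negate_odd flip_one_negate)
    then show "conjugate_in W (w_o n \<otimes>\<^bsub>W\<^esub> c_plus n) (c_plus n)"
      unfolding c_plus_eq mult(1)[OF cplus_fun_even] using conj[OF cplus_fun_even cplus_fun_even] h by blast
  next
    assume "odd half"
    then have h: "flip_one \<circ> negate_odd \<in> even_signed_perms N"
      using negate_odd_signed signature_negate_odd flip_one_N
      by (simp add: even_signed_perms_def signed_perms_comp signature_comp)
    have "cplus_fun \<circ> (flip_one \<circ> negate_odd) = (flip_one \<circ> negate_odd) \<circ> (negate \<circ> ?c)"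
      by (simp add: fun_eq_iff cplus_fun_def cfun_half_negate_odd)
    then show "conjugate_in W (w_o n \<otimes>\<^bsub>W\<^esub> c_minus n) (c_plus n)"
      unfolding c_minus_eq c_plus_eq mult(1)[OF c] using conj[OF c cplus_fun_even] h by blast
    have "?c \<circ> (flip_one \<circ> negate_odd) = (flip_one \<circ> negate_odd) \<circ> (negate \<circ> cplus_fun)"
      by (simp add: fun_eq_iff cplus_fun_def cfun_half_negate_odd flip_one_negate_odd flip_one_negate)
    then show "conjugate_in W (w_o n \<otimes>\<^bsub>W\<^esub> c_plus n) (c_minus n)"
      unfolding c_minus_eq c_plus_eq mult(1)[OF cplus_fun_even] using conj[OF cplus_fun_even c] h by blast
  }
qed

end

theorem mainTheorem5:
  fixes n :: nat
  assumes "n \<ge> 3" and "odd n"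
  shows
    "(\<forall>x. involution (W_D n) x \<longrightarrow>
        (\<exists>l k. l \<le> n \<and> k \<le> (n - l) div 2 \<and> conjugate_in (W_D n) x (c_inv n k l)) \<or>
        (conjugate_in (W_D n) x (c_minus n) \<noteq> conjugate_in (W_D n) x (c_plus n))) \<and>
     (\<forall>l k. l \<le> n \<and> k \<le> (n - l) div 2 \<longrightarrow>
        (standard_involution (D_nodes n) (D_matrix n) (c_inv n k l) \<longleftrightarrow> odd l \<or> l = 0)) \<and>
     (\<forall>l k. l \<le> n \<and> k \<le> (n - l) div 2 \<and> even l \<and> l \<ge> 2 \<longrightarrow>
        conjugate_in (W_D n) (c_inv n k l) (c_inv n k (l - 1))) \<and>
     (\<forall>l k. l \<le> n \<and> k \<le> (n - l) div 2 \<longrightarrow>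
        conjugate_in (W_D n) (w_o n \<otimes>\<^bsub>W_D n\<^esub> c_inv n k l) (c_inv n k (n - 2 * k - l))) \<and>
     ((n + 1) mod 4 = 0 \<longrightarrow>
        conjugate_in (W_D n) (w_o n \<otimes>\<^bsub>W_D n\<^esub> c_minus n) (c_minus n) \<and>
        conjugate_in (W_D n) (w_o n \<otimes>\<^bsub>W_D n\<^esub> c_plus n) (c_plus n)) \<and>
     ((n + 1) mod 4 = 2 \<longrightarrow>
        conjugate_in (W_D n) (w_o n \<otimes>\<^bsub>W_D n\<^esub> c_minus n) (c_plus n) \<and>
        conjugate_in (W_D n) (w_o n \<otimes>\<^bsub>W_D n\<^esub> c_plus n) (c_minus n))"
proof -
  interpret odd_type_D n using assms by unfold_locales
  have le: "2 * k + l \<le> n" if "l \<le> n \<and> k \<le> (n - l) div 2" for k l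
    using that by linarith
  have half: "(n + 1) mod 4 = 0 \<Longrightarrow> even (Suc n div 2)" "(n + 1) mod 4 = 2 \<Longrightarrow> odd (Suc n div 2)"
    by presburger+
  note v = conjugate_negate_c_minus_plus
  show ?thesis
    apply (intro conjI allI impI; (elim conjE)?)
    subgoal by (rule involution_classification)
    subgoal by (rule standard_iff[OF le[OF conjI]])
    subgoal by (rule conjugate_pred[OF le[OF conjI]])
    subgoal by (rule conjugate_negate_cfun[OF le[OF conjI]])
    subgoal by (rule v(1)[OF half(1)])
    subgoal by (rule v(2)[OF half(1)])
    subgoal by (rule v(3)[OF half(2)])
    subgoal by (rule v(4)[OF half(2)])
    done
qed

end
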